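(* Let $n\ge 1$ and $k\ge 1$ be integers, let $G: S^{4n-1}\rightarrow S^{2n}$ be a smooth map with nonzero Hopf invariant, and let $i: S^{2n}\rightarrow\mathbb{R}^k$ be a smooth embedding. Then $i\circ G$ admits smooth null-homotopies $F: B^{4n}\rightarrow\mathbb{R}^k$ with arbitrarily small $(2n+1)$-dilation; that is, for every $\epsilon>0$ there is a smooth map $F: B^{4n}\to\mathbb{R}^k$ with $F|_{S^{4n-1}}=i\circ G$ and $\mathrm{dil}_{2n+1}(F)<\epsilon$.
   Context: $B^{4n}$ is the closed unit ball in $\mathbb{R}^{4n}$ with boundary the round unit sphere $S^{4n-1}$; balls, spheres and $\mathbb{R}^k$ carry their standard metrics. For a $C^1$ map $F: M\to N$ of Riemannian manifolds, the $j$-dilation is $\mathrm{dil}_j(F)=\sup_{\Sigma^j\subset M}\frac{\mathrm{Vol}_j(F(\Sigma^j))}{\mathrm{Vol}_j(\Sigma^j)}$, the supremum over $j$-dimensional submanifolds $\Sigma^j$ of $M$; equivalently $\mathrm{dil}_j(F)=\sup_{x\in M}\prod_{l=1}^{j}s_l(x)$, where $s_1(x)\ge s_2(x)\ge\cdots$ are the singular values of $DF_x$ (with $s_l(x)=0$ for $l$ exceeding the number of singular values). The Hopf invariant of $G:S^{4n-1}\to S^{2n}$ is $\int_{S^{4n-1}}\alpha\wedge G^*\omega$, where $\omega$ is a $2n$-form on $S^{2n}$ with $\int_{S^{2n}}\omega=1$ and $d\alpha=G^*\omega$. *)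

theory Defs
  imports "HOL-Analysis.Analysis" "HOL-Combinatorics.Permutations" "HOL-Library.Multiset"
begin

section \<open>Smooth maps\<close>

primrec continuously_differentiable_on ::
  "nat \<Rightarrow> 'a::euclidean_space set \<Rightarrow> ('a \<Rightarrow> 'b::euclidean_space) \<Rightarrow> bool" where
  "continuously_differentiable_on 0 U f \<longleftrightarrow> continuous_on U f"
| "continuously_differentiable_on (Suc r) U f \<longleftrightarrow>
     (\<forall>x\<in>U. f differentiable (at x)) \<and>
     (\<forall>v. continuously_differentiable_on r U (\<lambda>x. frechet_derivative f (at x) v))"

text \<open>
  For the sphere and the closed ball this is the usual notion of a smooth map on a submanifold,
  respectively on a manifold with boundary.
\<close>

definition smooth_on :: "'a::euclidean_space set \<Rightarrow> ('a \<Rightarrow> 'b::euclidean_space) \<Rightarrow> bool" where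
  "smooth_on S f \<longleftrightarrow>
     (\<exists>U g. open U \<and> S \<subseteq> U \<and> (\<forall>r. continuously_differentiable_on r U g) \<and> (\<forall>x\<in>S. g x = f x))"

text \<open>The tangent space of the unit sphere at \<open>x\<close>.\<close>

definition sphere_tangent :: "'a::euclidean_space \<Rightarrow> 'a set" where
  "sphere_tangent x = {v. v \<bullet> x = 0}"

text \<open>
  Differentials of maps on the unit sphere \<open>S\<close> are rendered by
  \<open>frechet_derivative f (at x within S)\<close>. The derivative within \<open>S\<close> is not unique as a linear map
  on the ambient space, but its values on \<open>sphere_tangent x\<close> are: there it is the differential of
  the map \<open>f\<close> on \<open>S\<close>. Below it is therefore only ever evaluated at tangent vectors.
\<close>

definition smooth_sphere_embedding ::
  "('b::euclidean_space \<Rightarrow> 'c::euclidean_space) \<Rightarrow> bool" where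
  "smooth_sphere_embedding f \<longleftrightarrow>
     smooth_on (sphere 0 1) f \<and>
     (\<exists>g. homeomorphism (sphere 0 1) (f ` sphere 0 1) f g) \<and>
     (\<forall>x\<in>sphere 0 1. inj_on (frechet_derivative f (at x within sphere 0 1)) (sphere_tangent x))"

section \<open>Differential forms on the unit sphere\<close>

text \<open>
  A \<open>p\<close>-covector is a function of \<open>v :: nat \<Rightarrow> 'a\<close> that looks only at \<open>v 0, \<dots>, v (p - 1)\<close>.
\<close>

definition alternating_form ::
  "nat \<Rightarrow> ((nat \<Rightarrow> 'a::real_vector) \<Rightarrow> real) \<Rightarrow> bool" where
  "alternating_form p f \<longleftrightarrow>
     (\<forall>v w. (\<forall>i<p. v i = w i) \<longrightarrow> f v = f w) \<and>
     (\<forall>v. \<forall>i<p. linear (\<lambda>x. f (v(i := x)))) \<and>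
     (\<forall>v. \<forall>i<p. \<forall>j<p. i \<noteq> j \<and> v i = v j \<longrightarrow> f v = 0)"

text \<open>
  A smooth \<open>p\<close>-form on the sphere is represented by a smooth field, along the sphere, of
  alternating \<open>p\<close>-covectors of the ambient space; the form itself is the restriction to tangent
  vectors. Every smooth form on the sphere has such a representative (compose with the
  orthogonal projections to the tangent spaces).
\<close>

definition smooth_sphere_form ::
  "nat \<Rightarrow> ('a::euclidean_space \<Rightarrow> (nat \<Rightarrow> 'a) \<Rightarrow> real) \<Rightarrow> bool" where
  "smooth_sphere_form p \<omega> \<longleftrightarrow>
     (\<forall>x\<in>sphere 0 1. alternating_form p (\<omega> x)) \<and>
     (\<forall>v. smooth_on (sphere 0 1) (\<lambda>x. \<omega> x v))"

definition sphere_form_eq ::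
  "('a::euclidean_space \<Rightarrow> (nat \<Rightarrow> 'a) \<Rightarrow> real) \<Rightarrow> ('a \<Rightarrow> (nat \<Rightarrow> 'a) \<Rightarrow> real) \<Rightarrow> bool" where
  "sphere_form_eq \<omega> \<eta> \<longleftrightarrow>
     (\<forall>x\<in>sphere 0 1. \<forall>v. (\<forall>i. v i \<in> sphere_tangent x) \<longrightarrow> \<omega> x v = \<eta> x v)"

text \<open>
  On tangent vectors this is the pullback to the sphere of the exterior derivative of any smooth
  extension of \<open>\<alpha>\<close> to an open set, hence the exterior derivative of the form that \<open>\<alpha>\<close>
  represents. In each summand the constant vectors \<open>v j\<close> with \<open>j \<noteq> i\<close> are held fixed.
\<close>

definition sphere_ext_deriv ::
  "nat \<Rightarrow> ('a::euclidean_space \<Rightarrow> (nat \<Rightarrow> 'a) \<Rightarrow> real) \<Rightarrow> 'a \<Rightarrow> (nat \<Rightarrow> 'a) \<Rightarrow> real" where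
  "sphere_ext_deriv p \<alpha> x v =
     (\<Sum>i\<le>p. (-1) ^ i *
        frechet_derivative (\<lambda>y. \<alpha> y (\<lambda>j. if j < i then v j else v (Suc j)))
          (at x within sphere 0 1) (v i))"

definition sphere_pullback ::
  "('a::euclidean_space \<Rightarrow> 'b::euclidean_space) \<Rightarrow> ('b \<Rightarrow> (nat \<Rightarrow> 'b) \<Rightarrow> real)
     \<Rightarrow> 'a \<Rightarrow> (nat \<Rightarrow> 'a) \<Rightarrow> real" where
  "sphere_pullback G \<omega> x v =
     \<omega> (G x) (\<lambda>i. frechet_derivative G (at x within sphere 0 1) (v i))"

definition wedge ::
  "nat \<Rightarrow> nat \<Rightarrow> ('a \<Rightarrow> (nat \<Rightarrow> 'a) \<Rightarrow> real) \<Rightarrow> ('a \<Rightarrow> (nat \<Rightarrow> 'a) \<Rightarrow> real)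
     \<Rightarrow> 'a \<Rightarrow> (nat \<Rightarrow> 'a) \<Rightarrow> real" where
  "wedge p q \<alpha> \<beta> x v =
     (\<Sum>\<sigma> | \<sigma> permutes {..<p + q}.
        of_int (sign \<sigma>) * \<alpha> x (\<lambda>i. v (\<sigma> i)) * \<beta> x (\<lambda>i. v (\<sigma> (p + i)))) / (fact p * fact q)"

section \<open>Integration over the unit sphere\<close>

text \<open>
  \<open>Basis\<close> is an unordered set; a fixed but unspecified enumeration of it orients the space. The
  Hopf invariant below does not depend on the orientation of the target, and reversing the
  orientation of the source only changes its sign.
\<close>

definition basis_enum :: "nat \<Rightarrow> 'a::euclidean_space" where
  "basis_enum = (SOME b. bij_betw b {..<DIM('a)} Basis)"

definition frame_det :: "(nat \<Rightarrow> 'a::euclidean_space) \<Rightarrow> real" where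
  "frame_det e =
     (\<Sum>\<sigma> | \<sigma> permutes {..<DIM('a)}. of_int (sign \<sigma>) * (\<Prod>i<DIM('a). e i \<bullet> basis_enum (\<sigma> i)))"

text \<open>
  Oriented orthonormal frames of the tangent space at \<open>x\<close>, in the outward-normal-first
  convention.
\<close>

definition oriented_sphere_frame :: "'a::euclidean_space \<Rightarrow> (nat \<Rightarrow> 'a) \<Rightarrow> bool" where
  "oriented_sphere_frame x e \<longleftrightarrow>
     (\<forall>i. e i \<in> sphere_tangent x) \<and>
     (\<forall>i<DIM('a) - 1. \<forall>j<DIM('a) - 1. e i \<bullet> e j = (if i = j then 1 else 0)) \<and>
     frame_det (case_nat x e) > 0"

text \<open>
  The surface measure, as the cone measure: a Borel set \<open>A\<close> of the sphere has area \<open>DIM('a)\<close>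
  times the volume of the cone \<open>{t *\<^sub>R x | t x. 0 < t \<and> t \<le> 1 \<and> x \<in> A}\<close>.
\<close>

definition sphere_measure :: "'a::euclidean_space measure" where
  "sphere_measure =
     distr (density lborel (\<lambda>x. of_nat DIM('a) * indicator (cball 0 1) x)) borel sgn"

text \<open>
  For a form \<open>\<eta>\<close> of degree \<open>DIM('a) - 1\<close>, the value at the chosen frame does not depend on the
  choice. The set integral matters: off the sphere the integrand is meaningless.
\<close>

definition sphere_form_integral ::
  "('a::euclidean_space \<Rightarrow> (nat \<Rightarrow> 'a) \<Rightarrow> real) \<Rightarrow> real" where
  "sphere_form_integral \<eta> =
     (LINT x:sphere 0 1|sphere_measure. \<eta> x (SOME e. oriented_sphere_frame x e))"

section \<open>The Hopf invariant\<close>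

text \<open>
  For a map \<open>G\<close> from the unit sphere of a \<open>4n\<close>-dimensional space to the unit sphere of a
  \<open>(2n + 1)\<close>-dimensional one.
\<close>

definition has_Hopf_invariant ::
  "nat \<Rightarrow> ('a::euclidean_space \<Rightarrow> 'b::euclidean_space) \<Rightarrow> real \<Rightarrow> bool" where
  "has_Hopf_invariant n G h \<longleftrightarrow>
     (\<exists>\<omega> \<alpha>.
        smooth_sphere_form (2 * n) \<omega> \<and> sphere_form_integral \<omega> = 1 \<and>
        smooth_sphere_form (2 * n - 1) \<alpha> \<and>
        sphere_form_eq (sphere_ext_deriv (2 * n - 1) \<alpha>) (sphere_pullback G \<omega>) \<and>
        h = sphere_form_integral (wedge (2 * n - 1) (2 * n) \<alpha> (sphere_pullback G \<omega>)))"

section \<open>Dilation\<close>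

text \<open>
  The singular values of \<open>L\<close>, with multiplicity and in decreasing order: the square roots of the
  eigenvalues of \<open>adjoint L \<circ> L\<close>. Indices start at \<open>0\<close>.
\<close>

definition singular_values ::
  "('a::euclidean_space \<Rightarrow> 'c::euclidean_space) \<Rightarrow> real list" where
  "singular_values L =
     rev (sorted_list_of_multiset
       (\<Sum>\<mu> | \<exists>v. v \<noteq> 0 \<and> adjoint L (L v) = \<mu> *\<^sub>R v.
          replicate_mset (dim {v. adjoint L (L v) = \<mu> *\<^sub>R v}) (sqrt \<mu>)))"

definition singular_value ::
  "('a::euclidean_space \<Rightarrow> 'c::euclidean_space) \<Rightarrow> nat \<Rightarrow> real" where
  "singular_value L l = (if l < length (singular_values L) then singular_values L ! l else 0)"

text \<open>
  The largest factor by which the differential expands \<open>j\<close>-dimensional volume, that is, the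
  supremum over the points of \<open>M\<close> of the product of the \<open>j\<close> largest singular values. It is meant
  for \<open>M\<close> a full-dimensional convex set, such as the closed ball, in a Euclidean space, so that
  the derivative within \<open>M\<close> is unique also at boundary points.
\<close>

definition dil ::
  "nat \<Rightarrow> 'a::euclidean_space set \<Rightarrow> ('a \<Rightarrow> 'c::euclidean_space) \<Rightarrow> ennreal" where
  "dil j M F =
     (SUP x\<in>M. ennreal (\<Prod>l<j. singular_value (frechet_derivative F (at x within M)) l))"

end

theory Submission
  imports Defs
begin

text \<open>
  Write \<open>g = i \<circ> G\<close>. The null-homotopy has the form \<open>F x = t x *\<^sub>R g (p x)\<close> with a real function
  \<open>t\<close> and a map \<open>p\<close> from the ball to the sphere, defined where \<open>t \<noteq> 0\<close>. As \<open>g\<close> factors through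
  \<open>S\<^sup>2\<^sup>n\<close>, the differential of \<open>F\<close> has rank at most \<open>2 * n\<close> wherever \<open>t\<close> or \<open>p\<close> is
  stationary, so the \<open>(2 * n + 1)\<close>-dilation only counts points where both vary. Near the boundary
  \<open>t = 1\<close>, and \<open>p\<close> contracts the complement of a small disc to a point. Inside, \<open>p\<close> is constant
  outside a thin tube over that disc, which winds through the ball along a lattice path filling it,
  and in the tube \<open>p\<close> is the projection to the cross-section, opened up to the whole sphere. The
  value of \<open>t\<close> falls from 1 to 0 along the tube, and only in its straight pieces, so the shape of
  the bends is irrelevant. At scale 1 the tube has width about \<open>1 / M\<close> and length about
  \<open>M ^ (4 * n - 1)\<close>, so the dilation is of order \<open>M ^ (2 * n) / M ^ (4 * n - 1) \<le> 1 / M\<close>.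
\<close>

section \<open>Calculus of smooth maps\<close>

text \<open>The identity of the sphere does not extend over the ball, so \<open>p\<close> has to be
  undefined somewhere, \<open>t\<close> has to vanish there, and \<open>t\<close> must descend where
  \<open>p\<close> still varies. At such a point the differential of \<open>F\<close> is a map of
  rank at most \<open>2 * n\<close> plus a rank-one term from the slope of \<open>t\<close>, so the
  last of the \<open>2 * n + 1\<close> largest singular values is at most that slope times a bound
  on \<open>g\<close>. Only a long descent makes the slope small. Thinning the tube makes the other
  \<open>2 * n\<close> singular values grow, and the length that fits into the ball outweighs this
  because \<open>2 * n < 4 * n - 1\<close>, which is the condition \<open>n \<ge> 1\<close>. The
  construction lives on a ball of large radius \<open>R\<close> with unit cells, so that all bounds
  on the cross-section are free of \<open>M\<close>; the ball is rescaled only at the end. The maps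
  are global formulas, sums of cut-off terms, instead of glued pieces. Smoothness then comes almost
  for free, and the work lies in finding the terms that are active at a given point.\<close>

abbreviation C_on :: "nat \<Rightarrow> 'a::euclidean_space set \<Rightarrow> ('a \<Rightarrow> 'b::euclidean_space) \<Rightarrow> bool"
  where "C_on \<equiv> continuously_differentiable_on"

text \<open>Congruence is a premise because \<open>C_on_cong\<close> is itself proved with this
  rule, its induction hypothesis supplying congruence one order lower. \<open>C_on_Suc_intro\<close>
  then discharges the premise.\<close>

lemma C_on_SucI:
  assumes "\<And>x. x \<in> U \<Longrightarrow> (f has_derivative D x) (at x)" and "\<And>v. C_on r U (\<lambda>x. D x v)"
    and cong: "\<And>f g :: 'a \<Rightarrow> 'b. (\<forall>x\<in>U. f x = g x) \<Longrightarrow> C_on r U f \<Longrightarrow> C_on r U g"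
  shows "C_on (Suc r) U (f :: 'a::euclidean_space \<Rightarrow> 'b::euclidean_space)"
proof -
  have "frechet_derivative f (at x) = D x" if "x \<in> U" for x
    using frechet_derivative_at[OF assms(1)[OF that]] by simp
  then have "C_on r U (\<lambda>x. frechet_derivative f (at x) v)" for v
    by (intro cong[OF _ assms(2)[of v]]) auto
  then show ?thesis
    using assms(1) by (auto intro: differentiableI)
qed

lemma C_on_cong:
  assumes "open U" "\<forall>x\<in>U. f x = g x" "C_on r U f"
  shows "C_on r U g"
  using assms(2,3)
proof (induction r arbitrary: f g)
  case 0
  then show ?case by (simp cong: continuous_on_cong)
next
  case (Suc r)
  show ?case
  proof (rule C_on_SucI[where D = "\<lambda>x. frechet_derivative f (at x)"])
    show "(g has_derivative frechet_derivative f (at x)) (at x)" if "x \<in> U" for x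
    proof (rule has_derivative_transform_within_open[OF _ \<open>open U\<close> that])
      show "(f has_derivative frechet_derivative f (at x)) (at x)"
        using Suc.prems(2) that frechet_derivative_works by (metis continuously_differentiable_on.simps(2))
    qed (use Suc.prems in auto)
    show "C_on r U (\<lambda>x. frechet_derivative f (at x) v)" for v
      using Suc.prems by simp
    show "C_on r U g" if "\<forall>x\<in>U. f x = g x" "C_on r U f" for f g :: "'a \<Rightarrow> 'b"
      using Suc.IH that by blast
  qed
qed

lemma C_on_Suc_intro:
  assumes "open U" "\<And>x. x \<in> U \<Longrightarrow> (f has_derivative D x) (at x)" "\<And>v. C_on r U (\<lambda>x. D x v)"
  shows "C_on (Suc r) U f"
  using C_on_SucI[OF assms(2,3)] C_on_cong[OF assms(1)] by blast

lemma C_on_Suc_has_derivative: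
  assumes "C_on (Suc r) U f" "x \<in> U"
  shows "(f has_derivative frechet_derivative f (at x)) (at x)"
  using assms frechet_derivative_works by (metis continuously_differentiable_on.simps(2))

lemma C_on_Suc_partial: "C_on (Suc r) U f \<Longrightarrow> C_on r U (\<lambda>x. frechet_derivative f (at x) v)"
  by simp

lemma C_on_Suc_continuous: "C_on (Suc r) U f \<Longrightarrow> continuous_on U f"
  by (intro continuous_at_imp_continuous_on ballI has_derivative_continuous[OF C_on_Suc_has_derivative])

lemma C_on_mono: "C_on (Suc r) U f \<Longrightarrow> C_on r U f"
proof (induction r arbitrary: f)
  case 0
  then show ?case using C_on_Suc_continuous[OF 0] by simp
next
  case (Suc r)
  have "C_on r U (\<lambda>x. frechet_derivative f (at x) v)" for v
    using Suc.IH Suc.prems by simp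
  then show ?case using Suc.prems by simp
qed

lemma C_on_subset: "C_on r U f \<Longrightarrow> V \<subseteq> U \<Longrightarrow> C_on r V f"
  by (induction r arbitrary: f) (auto intro: continuous_on_subset)

lemma C_on_local:
  assumes "\<And>x. x \<in> U \<Longrightarrow> \<exists>V. open V \<and> x \<in> V \<and> C_on r V f"
  shows "C_on r U f"
  using assms
proof (induction r arbitrary: f)
  case 0
  show ?case unfolding continuously_differentiable_on.simps
  proof (rule continuous_at_imp_continuous_on, rule ballI)
    fix x assume "x \<in> U"
    then obtain V where "open V" "x \<in> V" "C_on 0 V f" using 0 by blast
    then have "open V" "x \<in> V" "continuous_on V f" by simp_all
    then show "isCont f x" using continuous_on_eq_continuous_at by blast
  qed
next
  case (Suc r)
  have "C_on r U (\<lambda>x. frechet_derivative f (at x) v)" for v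
  proof (rule Suc.IH)
    fix x assume "x \<in> U"
    then obtain V where "open V" "x \<in> V" "C_on (Suc r) V f" using Suc.prems by blast
    then show "\<exists>V. open V \<and> x \<in> V \<and> C_on r V (\<lambda>x. frechet_derivative f (at x) v)"
      using C_on_Suc_partial by blast
  qed
  moreover have "f differentiable (at x)" if "x \<in> U" for x
    using Suc.prems[OF that] by auto
  ultimately show ?case by simp
qed

lemma C_on_const: "C_on r U (\<lambda>x. c)"
  by (induction r arbitrary: c) simp_all

lemma C_on_bounded_linear:
  assumes "open U" "bounded_linear f"
  shows "C_on r U f"
proof (cases r)
  case 0
  then show ?thesis using assms linear_continuous_on by auto
next
  case (Suc k)
  show ?thesis unfolding Suc
    by (rule C_on_Suc_intro[OF assms(1), where D = "\<lambda>x. f"])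
      (simp_all add: C_on_const bounded_linear_imp_has_derivative assms)
qed

lemma C_on_add:
  assumes "open U" "C_on r U f" "C_on r U g"
  shows "C_on r U (\<lambda>x. f x + g x)"
  using assms(2,3)
proof (induction r arbitrary: f g)
  case 0
  then show ?case by (simp add: continuous_on_add)
next
  case (Suc r)
  show ?case
    by (rule C_on_Suc_intro[OF assms(1) has_derivative_add[OF Suc.prems[THEN C_on_Suc_has_derivative]]],
        assumption, assumption) (intro Suc.IH Suc.prems[THEN C_on_Suc_partial])
qed

lemma C_on_sum:
  assumes "open U" "\<And>i. i \<in> I \<Longrightarrow> C_on r U (f i)"
  shows "C_on r U (\<lambda>x. \<Sum>i\<in>I. f i x)"
  using assms(2)
  by (induction I rule: infinite_finite_induct) (auto intro: C_on_const C_on_add assms(1))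

lemma C_on_bilinear:
  fixes h :: "'b::euclidean_space \<Rightarrow> 'c::euclidean_space \<Rightarrow> 'd::euclidean_space"
  assumes "open U" "bounded_bilinear h" "C_on r U f" "C_on r U g"
  shows "C_on r U (\<lambda>x. h (f x) (g x))"
  using assms(3,4)
proof (induction r arbitrary: f g)
  case 0
  then show ?case by (simp add: bounded_bilinear.continuous_on assms(2))
next
  case (Suc r)
  show ?case
  proof (rule C_on_Suc_intro[OF assms(1) bounded_bilinear.FDERIV[OF assms(2) Suc.prems[THEN C_on_Suc_has_derivative]]])
    fix v
    show "C_on r U (\<lambda>x. h (f x) (frechet_derivative g (at x) v) + h (frechet_derivative f (at x) v) (g x))"
      using C_on_add[OF assms(1)
          Suc.IH[OF C_on_mono[OF Suc.prems(1)] C_on_Suc_partial[OF Suc.prems(2)]]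
          Suc.IH[OF C_on_Suc_partial[OF Suc.prems(1)] C_on_mono[OF Suc.prems(2)]]] .
  qed
qed

lemma C_on_compose:
  fixes f :: "'a::euclidean_space \<Rightarrow> 'b::euclidean_space" and g :: "'b \<Rightarrow> 'c::euclidean_space"
  assumes "open U" "open V" "C_on r U f" "C_on r V g" "\<And>x. x \<in> U \<Longrightarrow> f x \<in> V"
  shows "C_on r U (\<lambda>x. g (f x))"
  using assms(3,4)
proof (induction r arbitrary: g)
  case 0
  have "f ` U \<subseteq> V" using assms(5) by blast
  with 0 show ?case
    unfolding continuously_differentiable_on.simps by (metis continuous_on_compose2)
next
  case (Suc r)
  \<comment> \<open>In the chain rule the direction in which \<open>g\<close> is differentiated
    depends on \<open>x\<close>. Expanding it over \<open>Basis\<close> leaves partial derivatives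
    in fixed directions, to which the induction hypothesis applies.\<close>
  let ?D = "\<lambda>x v. \<Sum>b\<in>Basis. (frechet_derivative f (at x) v \<bullet> b) *\<^sub>R frechet_derivative g (at (f x)) b"
  show ?case
  proof (rule C_on_Suc_intro[OF assms(1), where D = ?D])
    fix x assume x: "x \<in> U"
    have dg: "(g has_derivative frechet_derivative g (at (f x))) (at (f x))"
      by (rule C_on_Suc_has_derivative[OF Suc.prems(2) assms(5)[OF x]])
    have "frechet_derivative g (at (f x)) w = (\<Sum>b\<in>Basis. (w \<bullet> b) *\<^sub>R frechet_derivative g (at (f x)) b)" for w
    proof -
      interpret linear "frechet_derivative g (at (f x))"
        by (rule has_derivative_linear[OF dg])
      have "frechet_derivative g (at (f x)) w
          = frechet_derivative g (at (f x)) (\<Sum>b\<in>Basis. (w \<bullet> b) *\<^sub>R b)"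
        by (simp only: euclidean_representation)
      also have "\<dots> = (\<Sum>b\<in>Basis. (w \<bullet> b) *\<^sub>R frechet_derivative g (at (f x)) b)"
        by (simp only: sum scaleR)
      finally show ?thesis .
    qed
    from ext[OF this] have D: "(\<lambda>v. frechet_derivative g (at (f x)) (frechet_derivative f (at x) v)) = ?D x" .
    show "((\<lambda>x. g (f x)) has_derivative ?D x) (at x)"
      using has_derivative_compose[OF C_on_Suc_has_derivative[OF Suc.prems(1) x] dg] unfolding D .
  next
    fix v
    have f': "C_on r U (\<lambda>x. frechet_derivative f (at x) v \<bullet> b)" for b
      using C_on_bilinear[OF assms(1) bounded_bilinear_inner C_on_Suc_partial[OF Suc.prems(1)] C_on_const] .
    have g': "C_on r U (\<lambda>x. frechet_derivative g (at (f x)) b)" for b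
      using Suc.IH[OF C_on_mono[OF Suc.prems(1)] C_on_Suc_partial[OF Suc.prems(2)]] .
    show "C_on r U (\<lambda>x. ?D x v)"
      by (rule C_on_sum[OF assms(1) C_on_bilinear[OF assms(1) bounded_bilinear_scaleR f' g']])
  qed
qed

definition smooth_on_open :: "'a::euclidean_space set \<Rightarrow> ('a \<Rightarrow> 'b::euclidean_space) \<Rightarrow> bool"
  where "smooth_on_open U f \<longleftrightarrow> open U \<and> (\<forall>r. C_on r U f)"

lemma smooth_open: "smooth_on_open U f \<Longrightarrow> open U"
  by (simp add: smooth_on_open_def)

lemma smooth_subset: "smooth_on_open U f \<Longrightarrow> open V \<Longrightarrow> V \<subseteq> U \<Longrightarrow> smooth_on_open V f"
  by (auto simp: smooth_on_open_def intro: C_on_subset)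

lemma smooth_C_on: "smooth_on_open U f \<Longrightarrow> C_on r U f"
  by (simp add: smooth_on_open_def)

lemma smooth_has_derivative:
  assumes "smooth_on_open U f" "x \<in> U"
  shows "(f has_derivative frechet_derivative f (at x)) (at x)"
  using C_on_Suc_has_derivative[OF smooth_C_on[OF assms(1)] assms(2)] .

lemma smooth_continuous_on: "smooth_on_open U f \<Longrightarrow> continuous_on U f"
  using smooth_C_on[of U f 0] by simp

lemma smooth_continuous_derivative:
  "smooth_on_open U f \<Longrightarrow> continuous_on U (\<lambda>x. frechet_derivative f (at x) v)"
  using C_on_Suc_partial[of 0 U f v] smooth_C_on[of U f "Suc 0"] by simp

lemma smooth_local:
  assumes "open U" "\<And>x. x \<in> U \<Longrightarrow> \<exists>V. x \<in> V \<and> smooth_on_open V f"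
  shows "smooth_on_open U f"
proof -
  have "C_on r U f" for r
  proof (rule C_on_local)
    fix x assume "x \<in> U"
    from assms(2)[OF this] obtain V where V: "x \<in> V" "smooth_on_open V f"
      by blast
    show "\<exists>V. open V \<and> x \<in> V \<and> C_on r V f"
      by (intro exI[of _ V] conjI V smooth_open[OF V(2)] smooth_C_on[OF V(2)])
  qed
  then show ?thesis using assms(1) by (simp add: smooth_on_open_def)
qed

lemma smooth_cong: "smooth_on_open U f \<Longrightarrow> (\<And>x. x \<in> U \<Longrightarrow> f x = g x) \<Longrightarrow> smooth_on_open U g"
  unfolding smooth_on_open_def using C_on_cong[of U f g] by simp

named_theorems smooth_intros

lemma smooth_const [smooth_intros]: "open U \<Longrightarrow> smooth_on_open U (\<lambda>x. c)"
  by (simp add: smooth_on_open_def C_on_const)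

lemma smooth_bounded_linear: "open U \<Longrightarrow> bounded_linear f \<Longrightarrow> smooth_on_open U f"
  by (simp add: smooth_on_open_def C_on_bounded_linear)

lemma smooth_id [smooth_intros]: "open U \<Longrightarrow> smooth_on_open U (\<lambda>x. x)"
  by (simp add: smooth_bounded_linear bounded_linear_ident)

lemma smooth_add [smooth_intros]:
  "smooth_on_open U f \<Longrightarrow> smooth_on_open U g \<Longrightarrow> smooth_on_open U (\<lambda>x. f x + g x)"
  by (simp add: smooth_on_open_def C_on_add)

lemma smooth_sum [smooth_intros]:
  "open U \<Longrightarrow> (\<And>i. i \<in> I \<Longrightarrow> smooth_on_open U (f i)) \<Longrightarrow> smooth_on_open U (\<lambda>x. \<Sum>i\<in>I. f i x)"
  by (simp add: smooth_on_open_def C_on_sum)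

lemma smooth_scaleR [smooth_intros]:
  "smooth_on_open U f \<Longrightarrow> smooth_on_open U g \<Longrightarrow> smooth_on_open U (\<lambda>x. f x *\<^sub>R g x)"
  by (simp add: smooth_on_open_def C_on_bilinear[OF _ bounded_bilinear_scaleR])

lemma smooth_mult [smooth_intros]:
  fixes f g :: "'a::euclidean_space \<Rightarrow> real"
  shows "smooth_on_open U f \<Longrightarrow> smooth_on_open U g \<Longrightarrow> smooth_on_open U (\<lambda>x. f x * g x)"
  by (simp add: smooth_on_open_def C_on_bilinear[OF _ bounded_bilinear_mult])

lemma smooth_inner [smooth_intros]:
  "smooth_on_open U f \<Longrightarrow> smooth_on_open U g \<Longrightarrow> smooth_on_open U (\<lambda>x. f x \<bullet> g x)"
  by (simp add: smooth_on_open_def C_on_bilinear[OF _ bounded_bilinear_inner])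

lemma smooth_diff [smooth_intros]:
  assumes "smooth_on_open U f" "smooth_on_open U g"
  shows "smooth_on_open U (\<lambda>x. f x - g x)"
  using smooth_add[OF assms(1) smooth_scaleR[OF smooth_const[OF smooth_open[OF assms(2)], of "-1"] assms(2)]]
  by simp

lemma smooth_divide_const [smooth_intros]:
  assumes "smooth_on_open U f"
  shows "smooth_on_open U (\<lambda>x. f x / (c::real))"
  using smooth_mult[OF assms smooth_const[OF smooth_open[OF assms], of "1 / c"]] by simp

lemma smooth_compose:
  assumes "smooth_on_open V g" "smooth_on_open U f" "\<And>x. x \<in> U \<Longrightarrow> f x \<in> V"
  shows "smooth_on_open U (\<lambda>x. g (f x))"
  using assms by (auto simp: smooth_on_open_def intro: C_on_compose)

lemma smooth_powr:
  "smooth_on_open {0<..} (\<lambda>x::real. x powr a)"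
proof -
  \<comment> \<open>The constant \<open>c\<close> is carried along so that the family is closed
    under differentiation.\<close>
  have "C_on r {0<..} (\<lambda>x. c * x powr a)" for r and c a :: real
  proof (induction r arbitrary: c a)
    case 0
    then show ?case by (auto intro!: continuous_intros)
  next
    case (Suc r)
    show ?case
    proof (rule C_on_Suc_intro[where D = "\<lambda>x v. (c * v * a) * x powr (a - 1)"])
      fix x :: real assume x: "x \<in> {0<..}"
      then have "((\<lambda>x. c * x powr a) has_field_derivative c * (a * x powr (a - 1))) (at x)"
        by (auto intro!: derivative_eq_intros)
      then show "((\<lambda>x. c * x powr a) has_derivative (\<lambda>v. (c * v * a) * x powr (a - 1))) (at x)"
        unfolding has_field_derivative_def by (rule has_derivative_eq_rhs) (simp add: fun_eq_iff)
    qed (use Suc.IH in auto)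
  qed
  from this[of _ 1 a] show ?thesis by (simp add: smooth_on_open_def)
qed

lemma smooth_normalize:
  assumes "smooth_on_open U f" "\<And>x. x \<in> U \<Longrightarrow> f x \<noteq> 0"
  shows "smooth_on_open U (\<lambda>x. f x /\<^sub>R norm (f x))"
proof -
  have "smooth_on_open U (\<lambda>x. (f x \<bullet> f x) powr (-1/2))"
    by (rule smooth_compose[OF smooth_powr smooth_inner[OF assms(1) assms(1)]]) (simp add: assms(2))
  from smooth_scaleR[OF this assms(1)] show ?thesis
    by (rule smooth_cong)
       (simp add: powr_minus norm_eq_sqrt_inner powr_half_sqrt)
qed

section \<open>A smooth step function\<close>

text \<open>The flat function \<open>exp (- 1 / x)\<close> times powers of \<open>1 / x\<close>; the
  powers make the family closed under differentiation.\<close>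

definition flat_exp :: "nat \<Rightarrow> real \<Rightarrow> real"
  where "flat_exp k x = (if x > 0 then inverse x ^ k * exp (- inverse x) else 0)"

lemma flat_exp_has_real_derivative:
  "(flat_exp k has_real_derivative flat_exp (k + 2) x - k * flat_exp (k + 1) x) (at x)"
proof -
  consider "x > 0" | "x < 0" | "x = 0" by linarith
  then show ?thesis
  proof cases
    case 1
    have inv: "(inverse has_real_derivative - (inverse x ^ 2)) (at x)"
      using DERIV_inverse[of x] 1 by (simp add: numeral_2_eq_2)
    have "((\<lambda>x. inverse x ^ k) has_real_derivative real k * (- (inverse x ^ 2) * inverse x ^ (k - 1))) (at x)"
      using DERIV_power[OF inv, of k] by simp
    also have "real k * (- (inverse x ^ 2) * inverse x ^ (k - 1)) = - real k * inverse x ^ (k + 1)"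
      by (cases k) (simp_all add: power2_eq_square algebra_simps)
    finally have pow: "((\<lambda>x. inverse x ^ k) has_real_derivative - real k * inverse x ^ (k + 1)) (at x)" .
    have "((\<lambda>x. exp (- inverse x)) has_real_derivative exp (- inverse x) * inverse x ^ 2) (at x)"
      using DERIV_chain2[OF DERIV_exp DERIV_minus[OF inv]] by simp
    from DERIV_mult[OF pow this]
    have "((\<lambda>x. inverse x ^ k * exp (- inverse x)) has_real_derivative
        flat_exp (k + 2) x - k * flat_exp (k + 1) x) (at x)"
      by (rule DERIV_cong) (use 1 in \<open>simp add: flat_exp_def algebra_simps power2_eq_square\<close>)
    then show ?thesis
      by (rule has_field_derivative_transform_within_open[of _ _ _ "{0<..}"]) (use 1 in \<open>auto simp: flat_exp_def\<close>)
  next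
    case 2
    have "((\<lambda>x. 0) has_real_derivative flat_exp (k + 2) x - k * flat_exp (k + 1) x) (at x)"
      using 2 by (simp add: flat_exp_def)
    then show ?thesis
      by (rule has_field_derivative_transform_within_open[of _ _ _ "{..<0}"]) (use 2 in \<open>auto simp: flat_exp_def\<close>)
  next
    case 3
    \<comment> \<open>Substituting \<open>t = 1 / h\<close> turns the right difference quotient at 0
      into this expression, so flatness at 0 is the dominance of \<open>exp\<close> at
      infinity.\<close>
    have "((\<lambda>t. t ^ Suc k / exp t) \<longlongrightarrow> (0::real)) at_top"
      by (rule tendsto_power_div_exp_0)
    moreover have "\<forall>\<^sub>F t in at_top. t ^ Suc k / exp t = flat_exp k (inverse t) / inverse t"
      using eventually_gt_at_top[of 0]
      by eventually_elim (simp add: flat_exp_def exp_minus field_simps)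
    ultimately have "((\<lambda>t. flat_exp k (inverse t) / inverse t) \<longlongrightarrow> 0) at_top"
      by (rule Lim_transform_eventually)
    then have right: "((\<lambda>h. flat_exp k h / h) \<longlongrightarrow> 0) (at_right 0)"
      by (simp add: filterlim_at_right_to_top)
    have "((\<lambda>h. flat_exp k h / h) \<longlongrightarrow> 0) (at_left 0)"
    proof (rule Lim_transform_eventually[OF tendsto_const])
      show "\<forall>\<^sub>F h in at_left 0. 0 = flat_exp k h / h"
        unfolding eventually_at_filter by (simp add: flat_exp_def)
    qed
    with right have "((\<lambda>h. flat_exp k h / h) \<longlongrightarrow> 0) (at 0)"
      by (simp add: filterlim_split_at)
    then show ?thesis using 3 by (simp add: DERIV_def flat_exp_def)
  qed
qed

lemma smooth_flat_exp: "smooth_on_open UNIV (flat_exp k)"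
proof -
  have "C_on r UNIV (\<lambda>x. flat_exp k x)" for r
  proof (induction r arbitrary: k)
    case 0
    show ?case
      using flat_exp_has_real_derivative
      by (auto intro!: continuous_at_imp_continuous_on DERIV_isCont)
  next
    case (Suc r)
    let ?D = "\<lambda>x v. v *\<^sub>R (flat_exp (k + 2) x + (- real k) * flat_exp (k + 1) x)"
    have D: "(flat_exp k has_derivative ?D x) (at x)" for x
      using flat_exp_has_real_derivative[of k x] unfolding has_field_derivative_def
      by (rule has_derivative_eq_rhs) (simp add: fun_eq_iff)
    have "C_on r UNIV (\<lambda>x. ?D x v)" for v
      by (intro C_on_bilinear[OF open_UNIV bounded_bilinear_scaleR C_on_const]
          C_on_add[OF open_UNIV Suc.IH] C_on_bilinear[OF open_UNIV bounded_bilinear_mult C_on_const Suc.IH])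
    from C_on_Suc_intro[OF open_UNIV D this] show ?case .
  qed
  then show ?thesis by (simp add: smooth_on_open_def)
qed

text \<open>The form with \<open>powr - 1\<close> lets \<open>smooth_powr\<close> give smoothness;
  \<open>smooth_step_eq\<close> is the usual quotient.\<close>

definition smooth_step :: "real \<Rightarrow> real"
  where "smooth_step x = flat_exp 0 x * (flat_exp 0 x + flat_exp 0 (1 - x)) powr - 1"

lemma flat_exp_denominator_pos: "flat_exp 0 x + flat_exp 0 (1 - x) > 0"
  by (simp add: flat_exp_def add_pos_pos)

lemma smooth_smooth_step: "smooth_on_open UNIV smooth_step"
proof -
  have "smooth_on_open UNIV (\<lambda>x. flat_exp 0 (1 - x))"
    by (rule smooth_compose[OF smooth_flat_exp]) (auto intro!: smooth_intros)
  then have "smooth_on_open UNIV (\<lambda>x. flat_exp 0 x + flat_exp 0 (1 - x))"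
    by (intro smooth_add smooth_flat_exp)
  then have "smooth_on_open UNIV (\<lambda>x. (flat_exp 0 x + flat_exp 0 (1 - x)) powr - 1)"
    by (rule smooth_compose[OF smooth_powr]) (simp add: flat_exp_denominator_pos)
  then have "smooth_on_open UNIV (\<lambda>x. flat_exp 0 x * (flat_exp 0 x + flat_exp 0 (1 - x)) powr - 1)"
    by (intro smooth_mult smooth_flat_exp)
  then show ?thesis by (rule smooth_cong) (simp add: smooth_step_def)
qed

lemma smooth_step_eq: "smooth_step x = flat_exp 0 x / (flat_exp 0 x + flat_exp 0 (1 - x))"
  using flat_exp_denominator_pos[of x] by (simp add: smooth_step_def powr_minus divide_inverse)

lemma smooth_step_nonneg: "0 \<le> smooth_step x"
  by (simp add: smooth_step_def flat_exp_def)

lemma smooth_step_le_1: "smooth_step x \<le> 1"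
  unfolding smooth_step_eq using flat_exp_denominator_pos[of x]
  by (simp add: divide_le_eq_1 flat_exp_def)

lemma smooth_step_eq_0: "x \<le> 0 \<Longrightarrow> smooth_step x = 0"
  by (simp add: smooth_step_def flat_exp_def)

lemma smooth_step_eq_1: "x \<ge> 1 \<Longrightarrow> smooth_step x = 1"
  using flat_exp_denominator_pos[of x] unfolding smooth_step_eq
  by (simp add: flat_exp_def)

lemma smooth_step_comp [smooth_intros]: "smooth_on_open U f \<Longrightarrow> smooth_on_open U (\<lambda>x. smooth_step (f x))"
  by (rule smooth_compose[OF smooth_smooth_step]) auto

lemma smooth_step_derivative_bound:
  obtains C where "C \<ge> 0" "\<And>x. \<bar>frechet_derivative smooth_step (at x) 1\<bar> \<le> C"
proof -
  let ?D = "\<lambda>x. frechet_derivative smooth_step (at x) 1"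
  have "compact (?D ` {0..1})"
    by (rule compact_continuous_image[OF continuous_on_subset[OF
          smooth_continuous_derivative[OF smooth_smooth_step, of 1]]]) simp_all
  then have "bounded (?D ` {0..1})" by (rule compact_imp_bounded)
  then obtain C where "\<forall>y\<in>?D ` {0..1}. norm y \<le> C" unfolding bounded_iff ..
  then have C: "\<And>x. x \<in> {0..1} \<Longrightarrow> \<bar>?D x\<bar> \<le> C" by simp
  have const: "?D x = 0" if "open S" "x \<in> S" "\<And>y. y \<in> S \<Longrightarrow> smooth_step y = c" for x S c
  proof -
    have "((\<lambda>_. c) has_derivative (\<lambda>_. 0)) (at x)" by simp
    then have "(smooth_step has_derivative (\<lambda>_. 0)) (at x)"
      by (rule has_derivative_transform_within_open[OF _ that(1,2)]) (simp add: that(3))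
    from frechet_derivative_at[OF this] show ?thesis by (simp add: fun_eq_iff)
  qed
  have "\<bar>?D x\<bar> \<le> max C 0" for x
  proof (cases "x \<in> {0..1}")
    case True
    then show ?thesis using C[of x] by simp
  next
    case False
    then consider "x \<in> {..<0}" | "x \<in> {1<..}" by fastforce
    then have "?D x = 0"
    proof cases
      case 1
      then show ?thesis by (rule const[OF open_lessThan]) (simp add: smooth_step_eq_0)
    next
      case 2
      then show ?thesis by (rule const[OF open_greaterThan]) (simp add: smooth_step_eq_1)
    qed
    then show ?thesis by simp
  qed
  then show ?thesis using that[of "max C 0"] by simp
qed

section \<open>Singular values and dilation\<close>

text \<open>Since \<open>L b \<bullet> L c = m c * (b \<bullet> c)\<close>, the images of orthogonal
  eigenvectors are orthogonal as well, and Pythagoras applies on both sides of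
  \<open>L\<close>.\<close>

lemma sum_orthogonal_eigenvectors_norm:
  fixes L :: "'a::euclidean_space \<Rightarrow> 'c::euclidean_space"
  assumes "linear L" "finite B" "pairwise orthogonal B"
    and eigen: "\<And>b. b \<in> B \<Longrightarrow> adjoint L (L b) = m b *\<^sub>R b"
  shows "(norm (L (\<Sum>b\<in>B. u b *\<^sub>R b)))\<^sup>2 = (\<Sum>b\<in>B. m b * (u b)\<^sup>2 * (norm b)\<^sup>2)"
    and "(norm (\<Sum>b\<in>B. u b *\<^sub>R b))\<^sup>2 = (\<Sum>b\<in>B. (u b)\<^sup>2 * (norm b)\<^sup>2)"
proof -
  interpret L: linear L by fact
  have inner: "L b \<bullet> L c = m c * (b \<bullet> c)" if "c \<in> B" for b c
    using adjoint_works[OF assms(1), of b "L c"] eigen[OF that] by simp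
  have "(norm (L (\<Sum>b\<in>B. u b *\<^sub>R b)))\<^sup>2 = (norm (\<Sum>b\<in>B. u b *\<^sub>R L b))\<^sup>2"
    by (simp add: L.sum L.scaleR)
  also have "\<dots> = (\<Sum>b\<in>B. (norm (u b *\<^sub>R L b))\<^sup>2)"
    using assms(2,3) inner by (intro norm_sum_Pythagorean) (auto simp: pairwise_def orthogonal_def)
  also have "\<dots> = (\<Sum>b\<in>B. m b * (u b)\<^sup>2 * (norm b)\<^sup>2)"
    using inner by (intro sum.cong) (auto simp: power_mult_distrib power2_norm_eq_inner)
  finally show "(norm (L (\<Sum>b\<in>B. u b *\<^sub>R b)))\<^sup>2 = (\<Sum>b\<in>B. m b * (u b)\<^sup>2 * (norm b)\<^sup>2)" .
  have "(norm (\<Sum>b\<in>B. u b *\<^sub>R b))\<^sup>2 = (\<Sum>b\<in>B. (norm (u b *\<^sub>R b))\<^sup>2)"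
    using assms(2,3) by (intro norm_sum_Pythagorean) (auto simp: pairwise_def orthogonal_def)
  then show "(norm (\<Sum>b\<in>B. u b *\<^sub>R b))\<^sup>2 = (\<Sum>b\<in>B. (u b)\<^sup>2 * (norm b)\<^sup>2)"
    by (simp add: power_mult_distrib)
qed

context
  fixes L :: "'a::euclidean_space \<Rightarrow> 'c::euclidean_space"
  assumes L: "linear L"
begin

lemma subspace_eigenspace: "subspace {v. adjoint L (L v) = \<mu> *\<^sub>R v}"
proof -
  interpret L: linear L by (rule L)
  interpret A: linear "adjoint L" by (rule adjoint_linear[OF L])
  show ?thesis
    by (auto simp: subspace_def L.zero A.zero L.add A.add L.scaleR A.scaleR scaleR_add_right mult.commute)
qed

lemma eigenvalue_norm:
  assumes "adjoint L (L v) = \<mu> *\<^sub>R v"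
  shows "\<mu> * (norm v)\<^sup>2 = (norm (L v))\<^sup>2"
  using adjoint_works[OF L, of v "L v"] assms by (simp add: power2_norm_eq_inner)

lemma eigenvectors_orthogonal:
  assumes "adjoint L (L v) = \<mu> *\<^sub>R v" "adjoint L (L w) = \<nu> *\<^sub>R w" "\<mu> \<noteq> \<nu>"
  shows "v \<bullet> w = 0"
proof -
  have "\<nu> * (v \<bullet> w) = L v \<bullet> L w"
    using adjoint_works[OF L, of v "L w"] assms(2) by simp
  also have "\<dots> = \<mu> * (v \<bullet> w)"
    using adjoint_works[OF L, of w "L v"] assms(1) by (simp add: inner_commute)
  finally show ?thesis using assms(3) by simp
qed

text \<open>
  On the span of these eigenspaces \<open>L\<close> expands by more than \<open>e\<close>, so the span meets the kernel of
  \<open>L'\<close> only in 0.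
\<close>

lemma sum_dim_eigenspaces_le:
  assumes "finite T" "\<And>\<mu>. \<mu> \<in> T \<Longrightarrow> \<mu> > e\<^sup>2" "e \<ge> 0"
    and L': "linear L'" "range L' \<subseteq> W" "dim W \<le> r" "\<And>v. norm (L v - L' v) \<le> e * norm v"
  shows "(\<Sum>\<mu>\<in>T. dim {v. adjoint L (L v) = \<mu> *\<^sub>R v}) \<le> r"
proof -
  let ?E = "\<lambda>\<mu>. {v. adjoint L (L v) = \<mu> *\<^sub>R v}"
  have "\<exists>B. 0 \<notin> B \<and> B \<subseteq> ?E \<mu> \<and> pairwise orthogonal B \<and> independent B \<and> card B = dim (?E \<mu>)" for \<mu>
    using orthogonal_basis_subspace[OF subspace_eigenspace, of \<mu>] by metis
  then obtain B where B: "\<And>\<mu>. 0 \<notin> B \<mu>" "\<And>\<mu>. B \<mu> \<subseteq> ?E \<mu>" "\<And>\<mu>. pairwise orthogonal (B \<mu>)"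
      "\<And>\<mu>. independent (B \<mu>)" "\<And>\<mu>. card (B \<mu>) = dim (?E \<mu>)"
    by metis
  have fin: "finite (B \<mu>)" for \<mu>
    using B(4) independent_imp_finite by blast
  let ?B = "\<Union>\<mu>\<in>T. B \<mu>"
  have orth: "v \<bullet> w = 0" if "v \<in> B \<mu>" "w \<in> B \<nu>" "v \<noteq> w" for v w \<mu> \<nu>
  proof (cases "\<mu> = \<nu>")
    case True
    then show ?thesis using that B(3)[of \<mu>] by (auto simp: pairwise_def orthogonal_def)
  next
    case False
    then show ?thesis using that B(2) eigenvectors_orthogonal[of v \<mu> w \<nu>] by blast
  qed
  have disj: "B \<mu> \<inter> B \<nu> = {}" if "\<mu> \<noteq> \<nu>" for \<mu> \<nu>
  proof -
    have False if v: "v \<in> B \<mu>" "v \<in> B \<nu>" for v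
    proof -
      have "v \<bullet> v = 0" using v B(2) eigenvectors_orthogonal[of v \<mu> v \<nu>] \<open>\<mu> \<noteq> \<nu>\<close> by blast
      then show False using v B(1)[of \<mu>] by auto
    qed
    then show ?thesis by blast
  qed
  have finB: "finite ?B" using assms(1) fin by blast
  have orthB: "pairwise orthogonal ?B"
    unfolding pairwise_def orthogonal_def using orth by blast
  have indep: "independent ?B"
    using pairwise_orthogonal_independent[OF orthB] B(1) by blast
  define m where "m b = (THE \<mu>. \<mu> \<in> T \<and> b \<in> B \<mu>)" for b
  have m: "m b = \<mu>" if "\<mu> \<in> T" "b \<in> B \<mu>" for b \<mu>
    unfolding m_def using that disj by blast
  have eigen: "adjoint L (L b) = m b *\<^sub>R b" if "b \<in> ?B" for b
    using that B(2) m by blast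
  have big: "m b > e\<^sup>2" if "b \<in> ?B" for b
    using that m assms(2) by auto
  have ker: "v = 0" if v: "v \<in> span ?B" "L' v = 0" for v
  proof -
    obtain u where u: "v = (\<Sum>b\<in>?B. u b *\<^sub>R b)"
      using v(1) span_finite[OF finB] by auto
    have "(norm (L v))\<^sup>2 \<le> (e * norm v)\<^sup>2"
      using L'(4)[of v] v(2) by (intro power_mono) auto
    then have "(\<Sum>b\<in>?B. m b * (u b)\<^sup>2 * (norm b)\<^sup>2) \<le> (\<Sum>b\<in>?B. e\<^sup>2 * ((u b)\<^sup>2 * (norm b)\<^sup>2))"
      using sum_orthogonal_eigenvectors_norm[OF L finB orthB eigen, of u]
      by (simp add: u power_mult_distrib sum_distrib_left)
    then have "(\<Sum>b\<in>?B. (m b - e\<^sup>2) * ((u b)\<^sup>2 * (norm b)\<^sup>2)) \<le> 0"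
      by (simp add: left_diff_distrib sum_subtractf mult.assoc)
    moreover have "0 \<le> (m b - e\<^sup>2) * ((u b)\<^sup>2 * (norm b)\<^sup>2)" if "b \<in> ?B" for b
      using big[OF that] by simp
    ultimately have "\<forall>b\<in>?B. (m b - e\<^sup>2) * ((u b)\<^sup>2 * (norm b)\<^sup>2) = 0"
      using sum_nonneg_eq_0_iff[OF finB, of "\<lambda>b. (m b - e\<^sup>2) * ((u b)\<^sup>2 * (norm b)\<^sup>2)"]
        sum_nonneg[of ?B "\<lambda>b. (m b - e\<^sup>2) * ((u b)\<^sup>2 * (norm b)\<^sup>2)"] by force
    then have "u b = 0 \<or> b = 0" if "b \<in> ?B" for b
      using that big[OF that] by fastforce
    then have "u b *\<^sub>R b = 0" if "b \<in> ?B" for b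
      using that by fastforce
    then show "v = 0" unfolding u by (intro sum.neutral) blast
  qed
  have "inj_on L' (span ?B)"
    using ker linear_inj_on_iff_eq_0[OF L'(1) subspace_span] by blast
  then have "dim (L' ` ?B) = dim ?B" by (rule dim_image_eq[OF L'(1)])
  moreover have "dim ?B = card ?B" using indep by (rule dim_eq_card_independent)
  moreover have "card ?B = (\<Sum>\<mu>\<in>T. card (B \<mu>))"
    using assms(1) fin disj by (intro card_UN_disjoint) auto
  moreover have "dim (L' ` ?B) \<le> dim W"
    using L'(2) by (intro dim_subset) auto
  ultimately show ?thesis using B(5) L'(3) by simp
qed

definition singular_mset :: "real multiset"
  where "singular_mset = (\<Sum>\<mu> | \<exists>v. v \<noteq> 0 \<and> adjoint L (L v) = \<mu> *\<^sub>R v.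
          replicate_mset (dim {v. adjoint L (L v) = \<mu> *\<^sub>R v}) (sqrt \<mu>))"

text \<open>If there were infinitely many eigenvalues, the defining sum would take its default
  value, the empty multiset. Hence no finiteness of the spectrum has to be established
  first.\<close>

lemma singular_msetD:
  assumes "s \<in># singular_mset"
  obtains \<mu> v where "v \<noteq> 0" "adjoint L (L v) = \<mu> *\<^sub>R v" "s = sqrt \<mu>"
proof (cases "finite {\<mu>. \<exists>v. v \<noteq> 0 \<and> adjoint L (L v) = \<mu> *\<^sub>R v}")
  case True
  show ?thesis
    using assms that unfolding singular_mset_def
    by (auto simp: set_mset_sum[OF True] split: if_splits)
next
  case False
  then show ?thesis using assms unfolding singular_mset_def by simp
qed

lemma singular_values_singular_mset: "singular_values L = rev (sorted_list_of_multiset singular_mset)"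
  by (simp add: singular_values_def singular_mset_def)

lemma singular_value_cases:
  obtains "singular_value L l = 0" | "singular_value L l \<in># singular_mset"
proof (cases "l < length (singular_values L)")
  case True
  then have "singular_value L l \<in> set (singular_values L)"
    by (simp add: singular_value_def)
  then show ?thesis using that(2) by (simp add: singular_values_singular_mset)
qed (simp add: singular_value_def that(1))

lemma singular_value_nonneg: "0 \<le> singular_value L l"
proof (cases rule: singular_value_cases[of l])
  case 2
  then obtain \<mu> v where v: "v \<noteq> 0" "adjoint L (L v) = \<mu> *\<^sub>R v" "singular_value L l = sqrt \<mu>"
    by (rule singular_msetD)
  then have "\<mu> \<ge> 0"
    using eigenvalue_norm[OF v(2)] zero_le_power2[of "norm (L v)"]
    by (metis linorder_not_less mult_neg_pos zero_less_norm_iff zero_less_power)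
  then show ?thesis using v(3) by simp
qed simp

lemma singular_value_le:
  assumes "B \<ge> 0" "\<And>v. norm (L v) \<le> B * norm v"
  shows "singular_value L l \<le> B"
proof (cases rule: singular_value_cases[of l])
  case 2
  then obtain \<mu> v where v: "v \<noteq> 0" "adjoint L (L v) = \<mu> *\<^sub>R v" "singular_value L l = sqrt \<mu>"
    by (rule singular_msetD)
  have "\<mu> * (norm v)\<^sup>2 \<le> B\<^sup>2 * (norm v)\<^sup>2"
    unfolding eigenvalue_norm[OF v(2)] power_mult_distrib[symmetric]
    using assms(2)[of v] by (intro power_mono) auto
  then have "\<mu> \<le> B\<^sup>2" using v(1) by simp
  then show ?thesis using v(3) assms(1) by (simp add: real_le_lsqrt)
qed (use assms in simp)

text \<open>The Eckart-Young bound. Indices start at 0, so this is the singular value number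
  \<open>r + 1\<close>; if it exceeded \<open>e\<close>, at least \<open>r + 1\<close> eigenvalues
  counted with multiplicity would exceed \<open>e\<^sup>2\<close>, against
  \<open>sum_dim_eigenspaces_le\<close>.\<close>

lemma singular_value_le_of_rank:
  assumes "e \<ge> 0"
    and L': "linear L'" "range L' \<subseteq> W" "dim W \<le> r" "\<And>v. norm (L v - L' v) \<le> e * norm v"
  shows "singular_value L r \<le> e"
proof (rule ccontr)
  assume "\<not> ?thesis"
  then have gt: "singular_value L r > e" by simp
  let ?S = "{\<mu>. \<exists>v. v \<noteq> 0 \<and> adjoint L (L v) = \<mu> *\<^sub>R v}"
  define xs where "xs = singular_values L"
  have r: "r < length xs" and xr: "xs ! r > e"
    using gt assms(1) unfolding singular_value_def xs_def by (auto split: if_splits)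
  have mset: "mset xs = singular_mset"
    by (simp add: xs_def singular_values_singular_mset)
  \<comment> \<open>Over an infinite set the sum would be the empty multiset, whereas
    \<open>xs\<close> has more than \<open>r\<close> entries.\<close>
  have fin: "finite ?S"
  proof (rule ccontr)
    assume "infinite ?S"
    then have "singular_mset = {#}" unfolding singular_mset_def by simp
    then show False using mset r by simp
  qed
  have "sorted (rev xs)" by (simp add: xs_def singular_values_singular_mset)
  then have all: "xs ! i > e" if "i \<le> r" for i
    using sorted_rev_nth_mono[of xs i r] r xr that by fastforce
  have "Suc r \<le> size (filter_mset (\<lambda>s. s > e) (mset xs))"
  proof -
    have "filter (\<lambda>s. s > e) (take (Suc r) xs) = take (Suc r) xs"
      using r all by (auto simp: filter_id_conv in_set_conv_nth)
    then have "Suc r = length (filter (\<lambda>s. s > e) (take (Suc r) xs))"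
      using r by simp
    also have "\<dots> \<le> length (filter (\<lambda>s. s > e) (take (Suc r) xs @ drop (Suc r) xs))"
      unfolding filter_append length_append by simp
    finally show ?thesis by (metis append_take_drop_id mset_filter size_mset)
  qed
  also have "size (filter_mset (\<lambda>s. s > e) (mset xs))
      = (\<Sum>\<mu>\<in>?S. if sqrt \<mu> > e then dim {v. adjoint L (L v) = \<mu> *\<^sub>R v} else 0)"
  proof -
    have size: "size (filter_mset P (replicate_mset k s)) = (if P s then k else 0)" for P k and s :: real
      by (induction k) auto
    have "size (filter_mset (\<lambda>s. s > e) (\<Sum>\<mu>\<in>T. replicate_mset (d \<mu>) (sqrt \<mu>)))
        = (\<Sum>\<mu>\<in>T. if sqrt \<mu> > e then d \<mu> else 0)" if "finite T" for T and d :: "real \<Rightarrow> nat"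
      using that by (induction T rule: finite_induct) (auto simp: size)
    from this[OF fin] show ?thesis unfolding mset singular_mset_def .
  qed
  also have "\<dots> = (\<Sum>\<mu>\<in>{\<mu>\<in>?S. sqrt \<mu> > e}. dim {v. adjoint L (L v) = \<mu> *\<^sub>R v})"
    by (rule sum.inter_filter[OF fin, symmetric])
  also have "\<dots> \<le> r"
  proof (rule sum_dim_eigenspaces_le[OF _ _ assms])
    show "e\<^sup>2 < \<mu>" if "\<mu> \<in> {\<mu>\<in>?S. sqrt \<mu> > e}" for \<mu>
    proof -
      have "\<not> \<mu> \<le> e\<^sup>2" using real_sqrt_le_mono[of \<mu> "e\<^sup>2"] that assms(1) by auto
      then show ?thesis by simp
    qed
  qed (use fin in auto)
  finally show False by simp
qed

lemma prod_singular_value_le: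
  assumes "e \<ge> 0" "B \<ge> 0" "\<And>v. norm (L v) \<le> B * norm v"
    and "linear L'" "range L' \<subseteq> W" "dim W \<le> r" "\<And>v. norm (L v - L' v) \<le> e * norm v"
  shows "(\<Prod>l<Suc r. singular_value L l) \<le> B ^ r * e"
proof -
  have "(\<Prod>l<r. singular_value L l) \<le> (\<Prod>l<r. B)"
    using singular_value_nonneg singular_value_le[OF assms(2,3)] by (intro prod_mono) auto
  then show ?thesis
    using singular_value_nonneg singular_value_le_of_rank[OF assms(1,4-7)] assms(1,2)
    by (simp add: mult_mono prod_nonneg)
qed

end

text \<open>By convexity every segment from \<open>x\<close> to a point \<open>q\<close> of the ball
  stays in the ball, so the one-sided derivative along it determines the differential on
  \<open>q - x\<close>. The choices \<open>q = 0\<close> and \<open>q\<close> a small multiple of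
  \<open>v\<close> then determine it on \<open>v\<close>, also when \<open>x\<close> is a boundary
  point.\<close>

lemma has_derivative_unique_cball:
  fixes f :: "'a::euclidean_space \<Rightarrow> 'c::euclidean_space"
  assumes "(f has_derivative D) (at x within cball 0 1)" "(f has_derivative D') (at x within cball 0 1)"
    and x: "x \<in> cball 0 1"
  shows "D = D'"
proof -
  interpret D: linear D using assms(1) by (rule has_derivative_linear)
  interpret D': linear D' using assms(2) by (rule has_derivative_linear)
  have eq: "D (q - x) = D' (q - x)" if q: "q \<in> cball 0 1" for q
  proof -
    let ?p = "\<lambda>t. x + t *\<^sub>R (q - x)"
    have sub: "?p ` {0..1} \<subseteq> cball 0 1"
    proof (clarify)
      fix t :: real assume t: "t \<in> {0..1}"
      have "(1 - t) *\<^sub>R x + t *\<^sub>R q \<in> cball 0 1"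
        using t by (intro convexD[OF convex_cball x q]) auto
      then show "?p t \<in> cball 0 1" by (simp add: algebra_simps)
    qed
    have der: "((\<lambda>t. f (?p t)) has_vector_derivative A (q - x)) (at 0 within {0..1})"
      if A: "(f has_derivative A) (at x within cball 0 1)" for A
    proof -
      interpret A: linear A using A by (rule has_derivative_linear)
      have "(?p has_derivative (\<lambda>t. t *\<^sub>R (q - x))) (at 0 within {0..1})"
        by (auto intro!: derivative_eq_intros)
      moreover have "(f has_derivative A) (at (?p 0) within ?p ` {0..1})"
        using has_derivative_subset[OF A sub] by simp
      ultimately have "((\<lambda>t. f (?p t)) has_derivative (\<lambda>t. A (t *\<^sub>R (q - x)))) (at 0 within {0..1})"
        by (rule has_derivative_in_compose)
      then show ?thesis by (simp add: has_vector_derivative_def A.scaleR)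
    qed
    show ?thesis
      using vector_derivative_unique_within_closed_interval[of 0 1 0, unfolded cbox_interval, OF _ _ der[OF assms(1)] der[OF assms(2)]]
      by simp
  qed
  show ?thesis
  proof
    fix v :: 'a
    define c where "c = 1 / (norm v + 1)"
    have c: "c > 0" "norm (c *\<^sub>R v) \<le> 1" by (auto simp: c_def add_nonneg_pos)
    have "D x = D' x" using eq[of 0] by (simp add: D.neg D'.neg)
    then have "D (c *\<^sub>R v) = D' (c *\<^sub>R v)" using eq[of "c *\<^sub>R v"] c(2) by (simp add: D.diff D'.diff)
    then show "D v = D' v" using c(1) by (simp add: D.scaleR D'.scaleR)
  qed
qed

lemma dil_cball_le:
  fixes F :: "'a::euclidean_space \<Rightarrow> 'c::euclidean_space"
  assumes "\<And>x. x \<in> cball 0 1 \<Longrightarrow> \<exists>D. (F has_derivative D) (at x) \<and> (\<Prod>l<j. singular_value D l) \<le> c"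
  shows "dil j (cball 0 1) F \<le> ennreal c"
  unfolding dil_def
proof (rule SUP_least)
  fix x :: 'a assume x: "x \<in> cball 0 1"
  from assms[OF x] obtain D where D: "(F has_derivative D) (at x)" "(\<Prod>l<j. singular_value D l) \<le> c"
    by blast
  have within: "(F has_derivative D) (at x within cball 0 1)"
    using D(1) by (rule has_derivative_at_withinI)
  then have "F differentiable (at x within cball 0 1)" by (rule differentiableI)
  then have "frechet_derivative F (at x within cball 0 1) = D"
    using has_derivative_unique_cball[OF _ within x] by (simp add: frechet_derivative_works)
  then show "ennreal (\<Prod>l<j. singular_value (frechet_derivative F (at x within cball 0 1)) l) \<le> ennreal c"
    using D(2) by (simp add: ennreal_leI)
qed

section \<open>Lattice paths\<close>

text \<open>A boustrophedon walk through the cube, that is, a reflected Gray code in base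
  \<open>M\<close>: the path for one axis fewer is run forwards and backwards in turn, and the new
  coordinate grows by 1 between two runs.\<close>

lemma lattice_path_exists:
  assumes "finite A" "M \<ge> 1"
  shows "\<exists>P :: nat \<Rightarrow> 'a \<Rightarrow> nat. (\<forall>i. P 0 i = 0) \<and>
      (\<forall>l<M ^ card A. \<forall>i\<in>A. P l i < M) \<and>
      (\<forall>l<M ^ card A. \<forall>l'<M ^ card A. (\<forall>i\<in>A. P l i = P l' i) \<longrightarrow> l = l') \<and>
      (\<forall>l. Suc l < M ^ card A \<longrightarrow> (\<exists>j\<in>A. (\<forall>i\<in>A. i \<noteq> j \<longrightarrow> P (Suc l) i = P l i) \<and>
          (P (Suc l) j = Suc (P l j) \<or> P l j = Suc (P (Suc l) j))))"
  using assms(1)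
proof (induction A rule: finite_induct)
  case empty
  then show ?case by (intro exI[of _ "\<lambda>_ _. 0"]) auto
next
  case (insert a A)
  define K where "K = M ^ card A"
  have K: "K > 0" "M ^ card (insert a A) = M * K"
    using insert assms(2) by (auto simp: K_def)
  from insert.IH obtain P :: "nat \<Rightarrow> 'a \<Rightarrow> nat" where P: "(\<forall>i. P 0 i = 0) \<and>
      (\<forall>l<K. \<forall>i\<in>A. P l i < M) \<and>
      (\<forall>l<K. \<forall>l'<K. (\<forall>i\<in>A. P l i = P l' i) \<longrightarrow> l = l') \<and>
      (\<forall>l. Suc l < K \<longrightarrow> (\<exists>j\<in>A. (\<forall>i\<in>A. i \<noteq> j \<longrightarrow> P (Suc l) i = P l i) \<and>
          (P (Suc l) j = Suc (P l j) \<or> P l j = Suc (P (Suc l) j))))"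
    unfolding K_def[symmetric] ..
  then have P0: "P 0 i = 0" for i by simp
  have less: "P l i < M" if "l < K" "i \<in> A" for l i
    using P that by simp
  have inj: "l = l'" if "l < K" "l' < K" "\<forall>i\<in>A. P l i = P l' i" for l l'
    using P that by simp
  have step: "\<exists>j\<in>A. (\<forall>i\<in>A. i \<noteq> j \<longrightarrow> P (Suc l) i = P l i) \<and>
          (P (Suc l) j = Suc (P l j) \<or> P l j = Suc (P (Suc l) j))" if "Suc l < K" for l
    using P that by simp
  \<comment> \<open>The position within the layer \<open>l div K\<close>. Odd layers are run
    backwards, so a layer starts over the point where the previous one ended.\<close>
  define f where "f l = (if even (l div K) then l mod K else K - 1 - l mod K)" for l
  have f: "f l < K" for l
    using K(1) mod_less_divisor[OF K(1), of l] by (auto simp: f_def)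
  define Q where "Q l = (P (f l))(a := l div K)" for l
  have QA: "Q l i = P (f l) i" if "i \<in> A" for l i
    using that insert.hyps(2) by (auto simp: Q_def)
  have Qa: "Q l a = l div K" for l by (simp add: Q_def)
  have "l = l'" if eq: "\<forall>i\<in>insert a A. Q l i = Q l' i" for l l'
  proof -
    have div: "l div K = l' div K" using eq Qa by simp
    have "f l = f l'" using eq QA by (intro inj f) auto
    moreover have "x = y" if "(if e then x else K - 1 - x) = (if e then y else K - 1 - y)" "x < K" "y < K"
      for e x y
      using that by (cases e) auto
    ultimately have "l mod K = l' mod K"
      using div mod_less_divisor[OF K(1)] unfolding f_def by metis
    with div show ?thesis by (metis div_mult_mod_eq)
  qed
  moreover have "\<exists>j\<in>insert a A. (\<forall>i\<in>insert a A. i \<noteq> j \<longrightarrow> Q (Suc l) i = Q l i) \<and>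
          (Q (Suc l) j = Suc (Q l j) \<or> Q l j = Suc (Q (Suc l) j))" for l
  proof (cases "Suc (l mod K) = K")
    case True
    then have "Suc l div K = Suc (l div K)" "Suc l mod K = 0"
      by (auto simp: div_Suc mod_Suc)
    then have "f (Suc l) = f l" using True by (auto simp: f_def)
    then show ?thesis
      using \<open>Suc l div K = _\<close> by (intro bexI[of _ a]) (auto simp: Q_def)
  next
    case False
    then have lt: "Suc (l mod K) < K" using mod_less_divisor[OF K(1), of l] by linarith
    have div: "Suc l div K = l div K" and md: "Suc l mod K = Suc (l mod K)"
      using False by (auto simp: div_Suc mod_Suc)
    have "\<exists>m. Suc m < K \<and> ((f l = m \<and> f (Suc l) = Suc m) \<or> (f l = Suc m \<and> f (Suc l) = m))"
    proof (cases "even (l div K)")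
      case True
      then show ?thesis using lt div md by (intro exI[of _ "l mod K"]) (auto simp: f_def)
    next
      case False
      then show ?thesis
        using lt div md by (intro exI[of _ "K - 2 - l mod K"]) (auto simp: f_def)
    qed
    then obtain m where m: "Suc m < K" "(f l = m \<and> f (Suc l) = Suc m) \<or> (f l = Suc m \<and> f (Suc l) = m)"
      by blast
    obtain i where i: "i \<in> A" "\<forall>k\<in>A. k \<noteq> i \<longrightarrow> P (Suc m) k = P m k"
        "P (Suc m) i = Suc (P m i) \<or> P m i = Suc (P (Suc m) i)"
      using step[OF m(1)] by blast
    have "Q (Suc l) k = Q l k" if "k \<in> insert a A" "k \<noteq> i" for k
      using that m(2) i(2) div by (cases "k = a") (auto simp: Qa QA)
    moreover have "Q (Suc l) i = Suc (Q l i) \<or> Q l i = Suc (Q (Suc l) i)"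
      using m(2) i(3) QA[OF i(1)] by auto
    ultimately show ?thesis using i(1) by blast
  qed
  moreover have "Q 0 i = 0" for i
    using K(1) by (simp add: Q_def f_def P0)
  moreover have "Q l i < M" if "l < M * K" "i \<in> insert a A" for l i
    using that less[OF f] QA Qa by (cases "i = a") (auto simp: less_mult_imp_div_less)
  ultimately show ?case unfolding K(2) by (intro exI[of _ Q]) blast
qed

section \<open>The tube\<close>

text \<open>\<open>bump\<close> vanishes off the disc of radius 1/8, so the map to the sphere is
  constant there. \<open>plateau\<close> is 1 on that disc and vanishes off the disc of radius 1/4,
  so \<open>tau\<close> is cut off only where the map to the sphere is constant. Radius 1/4 is less
  than half a cell and keeps the straight pieces away from the walls of the cells.\<close>

definition bump :: "'a::real_inner \<Rightarrow> real" where "bump z = smooth_step (2 - 128 * (z \<bullet> z))"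
definition plateau :: "'a::real_inner \<Rightarrow> real" where "plateau z = smooth_step (2 - 32 * (z \<bullet> z))"
definition smooth_sgn :: "real \<Rightarrow> real" where "smooth_sgn u = 2 * smooth_step (4 * u + 1/2) - 1"

lemma bump_eq_0: "z \<bullet> z \<ge> 1/64 \<Longrightarrow> bump z = 0"
  by (simp add: bump_def smooth_step_eq_0)

lemma bump_nonneg: "bump z \<ge> 0"
  by (simp add: bump_def smooth_step_nonneg)

lemma bump_0: "bump 0 = 1"
  by (simp add: bump_def smooth_step_eq_1)

lemma plateau_eq_1: "z \<bullet> z \<le> 1/64 \<Longrightarrow> plateau z = 1"
  by (simp add: plateau_def smooth_step_eq_1)

lemma plateau_eq_0: "z \<bullet> z \<ge> 1/16 \<Longrightarrow> plateau z = 0"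
  by (simp add: plateau_def smooth_step_eq_0)

lemma smooth_sgn_neg: "u \<le> - 1/8 \<Longrightarrow> smooth_sgn u = - 1"
  by (simp add: smooth_sgn_def smooth_step_eq_0)

lemma smooth_sgn_pos: "u \<ge> 1/8 \<Longrightarrow> smooth_sgn u = 1"
  by (simp add: smooth_sgn_def smooth_step_eq_1)

lemma abs_smooth_sgn_le: "\<bar>smooth_sgn u\<bar> \<le> 1"
  using smooth_step_nonneg[of "4 * u + 1/2"] smooth_step_le_1[of "4 * u + 1/2"]
  by (simp add: smooth_sgn_def abs_le_iff)

lemma smooth_bump [smooth_intros]: "smooth_on_open U f \<Longrightarrow> smooth_on_open U (\<lambda>x. bump (f x))"
  unfolding bump_def by (intro smooth_intros) (auto dest: smooth_open)

lemma smooth_plateau [smooth_intros]: "smooth_on_open U f \<Longrightarrow> smooth_on_open U (\<lambda>x. plateau (f x))"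
  unfolding plateau_def by (intro smooth_intros) (auto dest: smooth_open)

lemma smooth_smooth_sgn [smooth_intros]: "smooth_on_open U f \<Longrightarrow> smooth_on_open U (\<lambda>x. smooth_sgn (f x))"
  unfolding smooth_sgn_def by (intro smooth_intros) (auto dest: smooth_open)

text \<open>A nonnegative function has a minimum at each of its zeros, so its derivative vanishes
  there. This settles boundary points of the support of a cut-off, around which the cut-off is not
  identically zero.\<close>

lemma has_derivative_zero_at_zero:
  fixes p :: "'a::euclidean_space \<Rightarrow> real"
  assumes "smooth_on_open UNIV p" "smooth_on_open UNIV f" "\<And>y. p y \<ge> 0" "p x = 0"
  shows "((\<lambda>y. p y *\<^sub>R f y) has_derivative (\<lambda>_. 0)) (at x)"
proof -
  have p: "(p has_derivative frechet_derivative p (at x)) (at x)"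
    by (rule smooth_has_derivative[OF assms(1)]) simp
  have "frechet_derivative p (at x) = (\<lambda>h. 0)"
    by (rule has_derivative_local_min[OF p]) (simp add: assms)
  with p have "(p has_derivative (\<lambda>h. 0)) (at x)" by simp
  from has_derivative_scaleR[OF this smooth_has_derivative[OF assms(2) UNIV_I, of x]]
  show ?thesis by (simp add: assms(4))
qed

lemma abs_inner_Basis_less:
  fixes z :: "'a::euclidean_space"
  assumes "z \<bullet> z < 1/16" "i \<in> Basis"
  shows "\<bar>z \<bullet> i\<bar> < 1/4"
proof -
  have "(norm z)\<^sup>2 < (1/4)\<^sup>2" using assms(1) by (simp add: power2_norm_eq_inner) (simp add: power2_eq_square)
  then have "norm z < 1/4" by (rule power_less_imp_less_base) simp
  then show ?thesis using Basis_le_norm[OF assms(2), of z] by linarith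
qed

text \<open>After normalization this is the map from a cross-section to the sphere: the centre goes
  to \<open>- b\<close>, everything off the disc of radius 1/8 to \<open>b\<close>. It stays
  unnormalized so that its terms can be added and interpolated linearly.\<close>

definition tube_profile :: "'a::real_inner \<Rightarrow> 'a \<Rightarrow> 'a"
  where "tube_profile b z = b + bump z *\<^sub>R (z - 2 *\<^sub>R b)"

text \<open>Pairing with \<open>z\<close> leaves \<open>bump z * (z \<bullet> z)\<close>. If that is
  0, the profile is \<open>b\<close> or \<open>- b\<close>.\<close>

lemma tube_profile_neq_0:
  fixes b :: "'a::euclidean_space"
  assumes "b \<in> Basis" "z \<bullet> b = 0"
  shows "tube_profile b z \<noteq> 0"
proof
  assume 0: "tube_profile b z = 0"
  have "tube_profile b z \<bullet> z = bump z * (z \<bullet> z)"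
    using assms(2) by (simp add: tube_profile_def inner_left_distrib inner_diff_left inner_commute[of b])
  then have "z = 0 \<or> bump z = 0" using 0 by auto
  moreover have "b \<noteq> 0" using assms(1) nonzero_Basis by blast
  ultimately show False using 0 bump_0[where 'a = 'a] by (auto simp: tube_profile_def scaleR_2)
qed

lemma smooth_tube_profile [smooth_intros]:
  "smooth_on_open U f \<Longrightarrow> smooth_on_open U (\<lambda>x. tube_profile b (f x))"
  unfolding tube_profile_def by (intro smooth_intros) (auto dest: smooth_open)

text \<open>
  The ball is filled by one long tube around a lattice path. Its cross-sections are the unit cells
  around the lattice points \<open>P 0, P 1, \<dots>, P N\<close> of the hyperplane orthogonal to \<open>b0\<close>; the \<open>l\<close>-th
  straight piece runs in direction \<open>b0\<close> over the \<open>l\<close>-th cell, and consecutive pieces are joined by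
  bends, alternately at the top and at the bottom.
\<close>

locale snake =
  fixes b0 :: "'a::euclidean_space" and M N :: nat
    and P :: "nat \<Rightarrow> 'a \<Rightarrow> nat" and j :: "nat \<Rightarrow> 'a" and d :: "nat \<Rightarrow> real"
  assumes b0: "b0 \<in> Basis" and M: "M \<ge> 1" and N: "even N" "N \<ge> 2"
    and P0: "\<And>i. P 0 i = 0"
    and P_less: "\<And>l i. l \<le> N \<Longrightarrow> i \<in> Basis - {b0} \<Longrightarrow> P l i < M"
    and P_inj: "\<And>l l'. l \<le> N \<Longrightarrow> l' \<le> N \<Longrightarrow> \<forall>i\<in>Basis - {b0}. P l i = P l' i \<Longrightarrow> l = l'"
    and j: "\<And>l. l < N \<Longrightarrow> j l \<in> Basis - {b0}"
    and d: "\<And>l. l < N \<Longrightarrow> d l = 1 \<or> d l = - 1"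
    and P_step: "\<And>l. l < N \<Longrightarrow> real (P (Suc l) (j l)) = real (P l (j l)) + d l"
    and P_other: "\<And>l i. l < N \<Longrightarrow> i \<in> Basis - {b0} \<Longrightarrow> i \<noteq> j l \<Longrightarrow> P (Suc l) i = P l i"
begin

definition sg :: "nat \<Rightarrow> 'a \<Rightarrow> real" where "sg l i = (- 1) ^ P l i"

definition zc :: "nat \<Rightarrow> 'a \<Rightarrow> 'a"
  where "zc l x = (\<Sum>i\<in>Basis - {b0}. (sg l i * (x \<bullet> i - P l i)) *\<^sub>R i)"

text \<open>Signed distance from the common face of the cells \<open>l\<close> and
  \<open>Suc l\<close>, negative on the side of cell \<open>l\<close>.\<close>

definition u :: "nat \<Rightarrow> 'a \<Rightarrow> real"
  where "u l x = d l * (x \<bullet> j l - P l (j l)) - 1/2"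

text \<open>Zero at the heights 1 to \<open>M + 2\<close> of the straight pieces. Even links bend
  between \<open>M + 2\<close> and \<open>M + 3\<close>, odd links between 1 and 0.\<close>

definition kap :: "nat \<Rightarrow> real \<Rightarrow> real"
  where "kap l s = (if even l then smooth_step (s - M - 2) else smooth_step (1 - s))"

definition bend :: "nat \<Rightarrow> 'a \<Rightarrow> real"
  where "bend l x = 1/2 - smooth_sgn (u l x) * u l x - kap l (x \<bullet> b0)"

text \<open>
  The reflections \<open>sg\<close> make the coordinates of neighbouring cells mirror images of each other, so
  both are functions of the distance from the common face; adding \<open>kap\<close> to that distance
  cancels the mirror images against each other, which is the bend.
\<close>

definition q :: "nat \<Rightarrow> 'a \<Rightarrow> 'a"
  where "q l x = (\<Sum>i\<in>Basis - {b0}.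
    (if i = j l then sg l i * d l * bend l x else sg l i * (x \<bullet> i - P l i)) *\<^sub>R i)"

definition a :: "real \<Rightarrow> real" where "a s = smooth_step (2 * s - 5/2)"
definition th :: "real \<Rightarrow> real" where "th s = smooth_step ((s - 2) / M)"
definition cw :: "nat \<Rightarrow> real \<Rightarrow> real" where "cw l s = (if even l then a s else 1 - a s)"

text \<open>The position along the tube, counted in straight pieces: \<open>c + th\<close> on an
  even cell \<open>c\<close>, and \<open>c + 1 - th\<close> on an odd one. In a bend the factor of
  \<open>smooth_sgn\<close> is 0, so the position is constantly \<open>l + 1\<close> there although
  \<open>smooth_sgn\<close> varies.\<close>

definition vl :: "nat \<Rightarrow> 'a \<Rightarrow> real"
  where "vl l x = l + 1 + smooth_sgn (u l x) * (if even l then 1 - th (x \<bullet> b0) else th (x \<bullet> b0))"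

text \<open>
  The factor \<open>t\<close>: it drops by \<open>1 / N\<close> on each straight piece, between the heights 2 and
  \<open>M + 2\<close>. Between the heights 5/4 and 7/4 both bends at a cell contribute, and their weights
  \<open>cw\<close> add up to 1.
\<close>

definition tau :: "'a \<Rightarrow> real"
  where "tau x = 1 - (\<Sum>l<N. cw l (x \<bullet> b0) * plateau (q l x) * vl l x) / N"

abbreviation prof :: "'a \<Rightarrow> 'a" where "prof \<equiv> tube_profile b0"

text \<open>
  The map \<open>p\<close> is \<open>V\<close>, normalized. The sum in \<open>E\<close> omits the bottom bend at the end of the tube,
  where \<open>V\<close> therefore vanishes somewhere; the sum in \<open>tau\<close> includes it, so \<open>tau = 0\<close> around
  there.
\<close>

definition E :: "'a \<Rightarrow> 'a"
  where "E x = b0 + ((1 - a (x \<bullet> b0)) * bump (zc 0 x)) *\<^sub>R (zc 0 x - 2 *\<^sub>R b0)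
    + (\<Sum>l<N - 1. (cw l (x \<bullet> b0) * bump (q l x)) *\<^sub>R (q l x - 2 *\<^sub>R b0))"

text \<open>In the links all coordinates are at most \<open>M + 3\<close> in absolute value, so the
  links stay within radius \<open>R / 4\<close>. Beyond radius \<open>R / 2\<close> only the
  entrance of the tube, in the direction \<open>- b0\<close>, is left, and \<open>w\<close> switches
  from \<open>E\<close> to the identity out there.\<close>

definition R :: real where "R = 4 * DIM('a) * (M + 3)"
definition w :: "'a \<Rightarrow> real" where "w x = smooth_step (4 - 4 / R\<^sup>2 * (x \<bullet> x))"
definition V :: "'a \<Rightarrow> 'a" where "V x = (1 - w x) *\<^sub>R x + w x *\<^sub>R E x"

section \<open>Ranges and constant values of the weights\<close>

lemma a_bounds: "0 \<le> a s" "a s \<le> 1"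
  by (simp_all add: a_def smooth_step_nonneg smooth_step_le_1)

lemma cw_nonneg: "0 \<le> cw l s"
  using a_bounds by (simp add: cw_def)

lemma a_eq_0: "s \<le> 5/4 \<Longrightarrow> a s = 0"
  by (simp add: a_def smooth_step_eq_0)

lemma a_eq_1: "s \<ge> 7/4 \<Longrightarrow> a s = 1"
  by (simp add: a_def smooth_step_eq_1)

lemma th_eq_0: "s \<le> 2 \<Longrightarrow> th s = 0"
  using M by (simp add: th_def smooth_step_eq_0 divide_nonpos_pos)

lemma th_eq_1: "s \<ge> real M + 2 \<Longrightarrow> th s = 1"
  using M by (simp add: th_def smooth_step_eq_1)

lemma th_bounds: "0 \<le> th s" "th s \<le> 1"
  by (simp_all add: th_def smooth_step_nonneg smooth_step_le_1)

lemma kap_eq_0: "s \<ge> 1 \<Longrightarrow> s \<le> real M + 2 \<Longrightarrow> kap l s = 0"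
  by (simp add: kap_def smooth_step_eq_0)

lemma kap_nonneg: "0 \<le> kap l s"
  by (simp add: kap_def smooth_step_nonneg)

lemma sg_cases: "sg l i = 1 \<or> sg l i = - 1"
  by (simp add: sg_def) (metis neg_one_even_power neg_one_odd_power)

lemma sg_Suc_other: "l < N \<Longrightarrow> i \<in> Basis - {b0} \<Longrightarrow> i \<noteq> j l \<Longrightarrow> sg (Suc l) i = sg l i"
  by (simp add: sg_def P_other)

lemma sg_Suc_step:
  assumes "l < N"
  shows "sg (Suc l) (j l) = - sg l (j l)"
proof -
  have "P (Suc l) (j l) = Suc (P l (j l)) \<or> P l (j l) = Suc (P (Suc l) (j l))"
    using P_step[OF assms] d[OF assms] by linarith
  then show ?thesis by (auto simp: sg_def)
qed

section \<open>Coordinates in the cells and in the links\<close>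

lemma inner_sum_hyperplane_Basis:
  assumes "i \<in> Basis"
  shows "(\<Sum>k\<in>Basis - {b0}. f k *\<^sub>R k) \<bullet> i = (if i = b0 then 0 else f i)"
proof -
  have "(\<Sum>k\<in>Basis - {b0}. f k *\<^sub>R k) \<bullet> i = (\<Sum>k\<in>Basis - {b0}. if k = i then f k else 0)"
    unfolding inner_sum_left using assms by (intro sum.cong) (auto simp: inner_Basis)
  then show ?thesis using assms by simp
qed

lemma zc_inner: "i \<in> Basis - {b0} \<Longrightarrow> zc l x \<bullet> i = sg l i * (x \<bullet> i - P l i)"
  unfolding zc_def by (subst inner_sum_hyperplane_Basis) auto

lemma zc_inner_b0: "zc l x \<bullet> b0 = 0"
  unfolding zc_def using b0 by (subst inner_sum_hyperplane_Basis) auto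

lemma q_inner: "i \<in> Basis - {b0} \<Longrightarrow>
    q l x \<bullet> i = (if i = j l then sg l i * d l * bend l x else sg l i * (x \<bullet> i - P l i))"
  unfolding q_def by (subst inner_sum_hyperplane_Basis) auto

lemma q_inner_b0: "q l x \<bullet> b0 = 0"
  unfolding q_def using b0 by (subst inner_sum_hyperplane_Basis) auto

lemma abs_sg [simp]: "\<bar>sg l i\<bar> = 1"
  using sg_cases[of l i] by auto

lemma abs_d: "l < N \<Longrightarrow> \<bar>d l\<bar> = 1"
  using d[of l] by auto

lemma d_squared: "l < N \<Longrightarrow> d l * d l = 1"
  using d[of l] by auto

lemma q_eq_zc:
  assumes l: "l < N" and kap: "kap l (x \<bullet> b0) = 0" and u: "u l x \<le> - 1/8"
  shows "q l x = zc l x"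
proof -
  have "bend l x = d l * (x \<bullet> j l - P l (j l))"
    using smooth_sgn_neg[OF u] kap by (simp add: bend_def u_def)
  then have "d l * bend l x = x \<bullet> j l - P l (j l)"
    using d_squared[OF l] by (metis mult.assoc mult_1)
  then show ?thesis
    unfolding q_def zc_def by (intro sum.cong) (auto simp: mult.assoc)
qed

text \<open>Beyond the face \<open>bend\<close> measures the distance from the next lattice point,
  with the opposite sign; the sign change of \<open>sg\<close> along the step compensates for
  this.\<close>

lemma q_eq_zc_Suc:
  assumes l: "l < N" and kap: "kap l (x \<bullet> b0) = 0" and u: "u l x \<ge> 1/8"
  shows "q l x = zc (Suc l) x"
proof -
  have "bend l x = 1 - d l * (x \<bullet> j l - P l (j l))"
    using smooth_sgn_pos[OF u] kap by (simp add: bend_def u_def)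
  then have "d l * bend l x = d l - (d l * d l) * (x \<bullet> j l - P l (j l))"
    by (simp only:) (simp add: algebra_simps)
  then have "d l * bend l x = - (x \<bullet> j l - P (Suc l) (j l))"
    using d_squared[OF l] P_step[OF l] by simp
  then have "sg l (j l) * d l * bend l x = sg (Suc l) (j l) * (x \<bullet> j l - P (Suc l) (j l))"
    using sg_Suc_step[OF l] by (metis (no_types, lifting) minus_mult_commute mult.assoc)
  then show ?thesis
    unfolding q_def zc_def using sg_Suc_other[OF l] P_other[OF l] by (intro sum.cong) auto
qed

lemma u_le_of_zc:
  assumes "l < N" "zc l x \<bullet> zc l x < 1/16"
  shows "u l x \<le> - 1/8"
proof -
  have "\<bar>zc l x \<bullet> j l\<bar> < 1/4" using abs_inner_Basis_less[OF assms(2)] j[OF assms(1)] by blast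
  then have "\<bar>x \<bullet> j l - P l (j l)\<bar> < 1/4" using zc_inner[OF j[OF assms(1)]] by (simp add: abs_mult)
  then have "\<bar>d l * (x \<bullet> j l - P l (j l))\<bar> < 1/4" using abs_d[OF assms(1)] by (simp add: abs_mult)
  then show ?thesis by (simp add: u_def)
qed

lemma u_ge_of_zc_Suc:
  assumes "l < N" "zc (Suc l) x \<bullet> zc (Suc l) x < 1/16"
  shows "u l x \<ge> 1/8"
proof -
  have "\<bar>zc (Suc l) x \<bullet> j l\<bar> < 1/4" using abs_inner_Basis_less[OF assms(2)] j[OF assms(1)] by blast
  then have "\<bar>x \<bullet> j l - P (Suc l) (j l)\<bar> < 1/4" using zc_inner[OF j[OF assms(1)]] by (simp add: abs_mult)
  then have "\<bar>d l * (x \<bullet> j l - P (Suc l) (j l))\<bar> < 1/4" using abs_d[OF assms(1)] by (simp add: abs_mult)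
  moreover have "d l * (x \<bullet> j l - P (Suc l) (j l)) = d l * (x \<bullet> j l - P l (j l)) - d l * d l"
    using P_step[OF assms(1)] by (simp add: algebra_simps)
  ultimately show ?thesis using d_squared[OF assms(1)] unfolding u_def by linarith
qed

section \<open>Confinement of the active links\<close>

lemma bend_bound:
  assumes "l < N" "q l x \<bullet> q l x < 1/16"
  shows "\<bar>bend l x\<bar> < 1/4"
proof -
  have "\<bar>q l x \<bullet> j l\<bar> < 1/4" using abs_inner_Basis_less[OF assms(2)] j[OF assms(1)] by blast
  then show ?thesis using q_inner[OF j[OF assms(1)]] abs_d[OF assms(1)] by (simp add: abs_mult)
qed

lemma abs_smooth_sgn_mult_le: "\<bar>smooth_sgn t * t\<bar> \<le> \<bar>t\<bar>"
  using abs_smooth_sgn_le[of t] by (simp add: abs_mult mult_left_le_one_le)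

lemma u_bounds:
  assumes "l < N" "q l x \<bullet> q l x < 1/16"
  shows "\<bar>u l x\<bar> < 3/4"
proof (cases "\<bar>u l x\<bar> \<le> 1/8")
  case False
  then have "smooth_sgn (u l x) * u l x = \<bar>u l x\<bar>"
    using smooth_sgn_neg[of "u l x"] smooth_sgn_pos[of "u l x"] by (cases "u l x \<ge> 0") auto
  then show ?thesis
    using bend_bound[OF assms] kap_nonneg[of l "x \<bullet> b0"] unfolding bend_def by linarith
qed simp

text \<open>Where \<open>kap\<close> is 1, \<open>bend\<close> is at most -3/8 and the point is
  outside the link: the bend has closed. This is what bounds the heights that the links
  reach.\<close>

lemma kap_less_1:
  assumes "l < N" "q l x \<bullet> q l x < 1/16"
  shows "kap l (x \<bullet> b0) < 1"
proof (cases "\<bar>u l x\<bar> \<le> 1/8")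
  case True
  then show ?thesis
    using bend_bound[OF assms] abs_smooth_sgn_mult_le[of "u l x"] unfolding bend_def by linarith
next
  case False
  then have "smooth_sgn (u l x) * u l x = \<bar>u l x\<bar>"
    using smooth_sgn_neg[of "u l x"] smooth_sgn_pos[of "u l x"] by (cases "u l x \<ge> 0") auto
  then show ?thesis using bend_bound[OF assms] unfolding bend_def by linarith
qed

text \<open>Where \<open>kap\<close> vanishes, points within 1/8 of the common face have
  \<open>bend\<close> at least 1/4 and are inactive. So the smoothing of the absolute value of
  \<open>u\<close> is invisible on the straight pieces.\<close>

lemma q_cases:
  assumes "l < N" "kap l (x \<bullet> b0) = 0" "q l x \<bullet> q l x < 1/16"
  obtains "u l x < - 1/8" "q l x = zc l x" | "u l x > 1/8" "q l x = zc (Suc l) x"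
proof (cases "\<bar>u l x\<bar> \<le> 1/8")
  case True
  then have "\<bar>bend l x\<bar> \<ge> 1/4"
    using assms(2) abs_smooth_sgn_mult_le[of "u l x"] by (simp add: bend_def abs_le_iff abs_if split: if_splits)
  then show ?thesis using bend_bound[OF assms(1,3)] by simp
next
  case False
  then consider "u l x < - 1/8" | "u l x > 1/8" by linarith
  then show ?thesis
    using that q_eq_zc[OF assms(1,2)] q_eq_zc_Suc[OF assms(1,2)] by cases auto
qed

text \<open>Rounding by \<open>floor\<close> makes the unit cells half-open and thus disjoint, so
  that a point belongs to at most one of them even on a common face.\<close>

definition near :: "nat \<Rightarrow> 'a \<Rightarrow> bool"
  where "near c x \<longleftrightarrow> (\<forall>i\<in>Basis - {b0}. \<lfloor>x \<bullet> i + 1/2\<rfloor> = int (P c i))"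

lemma near_unique: "near c x \<Longrightarrow> near c' x \<Longrightarrow> c \<le> N \<Longrightarrow> c' \<le> N \<Longrightarrow> c = c'"
  by (intro P_inj) (auto simp: near_def)

lemma near_zc:
  assumes "zc c x \<bullet> zc c x < 1/16"
  shows "near c x"
  unfolding near_def
proof
  fix i assume i: "i \<in> Basis - {b0}"
  have "\<bar>zc c x \<bullet> i\<bar> < 1/4" using abs_inner_Basis_less[OF assms] i by blast
  then have "\<bar>x \<bullet> i - P c i\<bar> < 1/4" using zc_inner[OF i] by (simp add: abs_mult)
  then show "\<lfloor>x \<bullet> i + 1/2\<rfloor> = int (P c i)" unfolding abs_less_iff by (intro floor_unique) auto
qed

lemma near_q:
  assumes "l < N" "q l x \<bullet> q l x < 1/16"
  shows "near l x \<or> near (Suc l) x"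
proof -
  have other: "\<lfloor>x \<bullet> i + 1/2\<rfloor> = int (P l i)" if i: "i \<in> Basis - {b0}" "i \<noteq> j l" for i
  proof -
    have "\<bar>q l x \<bullet> i\<bar> < 1/4" using abs_inner_Basis_less[OF assms(2)] i by blast
    then have "\<bar>x \<bullet> i - P l i\<bar> < 1/4" using q_inner[OF i(1)] i(2) by (simp add: abs_mult)
    then show ?thesis unfolding abs_less_iff by (intro floor_unique) auto
  qed
  have "\<lfloor>x \<bullet> j l + 1/2\<rfloor> = int (P l (j l)) \<or> \<lfloor>x \<bullet> j l + 1/2\<rfloor> = int (P (Suc l) (j l))"
  proof -
    \<comment> \<open>These bounds put \<open>d l * (x \<bullet> j l - P l (j l))\<close> between
      -1/4 and 5/4, so rounding can only give one of the two lattice points of the link.\<close>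
    have b: "- (3/4) < u l x" "u l x < 3/4" using u_bounds[OF assms] by linarith+
    have S: "real (P (Suc l) (j l)) = real (P l (j l)) + d l" by (rule P_step[OF assms(1)])
    consider "d l = 1" | "d l = - 1" using d[OF assms(1)] by blast
    then show ?thesis
    proof cases
      case 1
      show ?thesis
      proof (cases "x \<bullet> j l - P l (j l) < 1/2")
        case True
        then have "\<lfloor>x \<bullet> j l + 1/2\<rfloor> = int (P l (j l))"
          using b 1 by (intro floor_unique) (auto simp: u_def)
        then show ?thesis by simp
      next
        case False
        then have "\<lfloor>x \<bullet> j l + 1/2\<rfloor> = int (P (Suc l) (j l))"
          using b 1 S by (intro floor_unique) (auto simp: u_def)
        then show ?thesis by simp
      qed
    next
      case 2
      show ?thesis
      proof (cases "x \<bullet> j l - P l (j l) < - 1/2")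
        case True
        then have "\<lfloor>x \<bullet> j l + 1/2\<rfloor> = int (P (Suc l) (j l))"
          using b 2 S by (intro floor_unique) (auto simp: u_def)
        then show ?thesis by simp
      next
        case False
        then have "\<lfloor>x \<bullet> j l + 1/2\<rfloor> = int (P l (j l))"
          using b 2 by (intro floor_unique) (auto simp: u_def)
        then show ?thesis by simp
      qed
    qed
  qed
  then show ?thesis
    unfolding near_def using other P_other[OF assms(1)] by metis
qed

text \<open>Links of equal parity use disjoint pairs of cells. So top bends do not interfere with
  each other, and neither do bottom bends.\<close>

lemma q_active_unique:
  assumes "l < N" "l' < N" "q l x \<bullet> q l x < 1/16" "q l' x \<bullet> q l' x < 1/16" "even l = even l'"
  shows "l = l'"
proof -
  obtain c where c: "c \<in> {l, Suc l}" "near c x" using near_q[OF assms(1,3)] by auto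
  obtain c' where c': "c' \<in> {l', Suc l'}" "near c' x" using near_q[OF assms(2,4)] by auto
  have "c = c'" using near_unique[OF c(2) c'(2)] c(1) c'(1) assms(1,2) by auto
  then show ?thesis using c(1) c'(1) assms(5) by auto
qed

lemma q_active_near:
  assumes "l < N" "q l x \<bullet> q l x < 1/16" "near c x" "c \<le> N"
  shows "c = l \<or> c = Suc l"
  using near_q[OF assms(1,2)] near_unique[OF assms(3) _ assms(4)] assms(1) by auto

end

lemma sum_eq_single:
  assumes "finite A" "l \<in> A" "\<And>k. k \<in> A \<Longrightarrow> k \<noteq> l \<Longrightarrow> f k = (0::'b::comm_monoid_add)"
  shows "sum f A = f l"
proof -
  have "sum f A = sum f {l}"
    using assms by (intro sum.mono_neutral_right) auto
  then show ?thesis by simp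
qed

lemma sum_eq_two:
  assumes "\<And>k. k < L \<Longrightarrow> k \<noteq> c \<Longrightarrow> Suc k \<noteq> c \<Longrightarrow> f k = (0::'b::comm_monoid_add)" "c \<le> L"
  shows "sum f {..<L} = (if c < L then f c else 0) + (if c \<ge> 1 then f (c - 1) else 0)"
proof -
  have "sum f {..<L} = sum f {k. k < L \<and> (k = c \<or> Suc k = c)}"
    using assms by (intro sum.mono_neutral_right) auto
  also have "{k. k < L \<and> (k = c \<or> Suc k = c)} = (if c < L then {c} else {}) \<union> (if c \<ge> 1 then {c - 1} else {})"
    using assms(2) by auto
  also have "sum f \<dots> = (if c < L then f c else 0) + (if c \<ge> 1 then f (c - 1) else 0)"
    by (subst sum.union_disjoint) auto
  finally show ?thesis .
qed

context snake begin

section \<open>Smoothness of the tube maps\<close>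

lemma smooth_coord [smooth_intros]: "smooth_on_open UNIV (\<lambda>x. x \<bullet> i)"
  by (intro smooth_intros) auto

lemma smooth_zc [smooth_intros]: "smooth_on_open UNIV (zc l)"
  unfolding zc_def[abs_def] by (intro smooth_intros) auto

lemma smooth_u [smooth_intros]: "smooth_on_open UNIV (u l)"
  unfolding u_def[abs_def] by (intro smooth_intros) auto

lemma smooth_kap [smooth_intros]: "smooth_on_open UNIV (\<lambda>x. kap l (x \<bullet> b0))"
  unfolding kap_def by (cases "even l") (simp_all, (intro smooth_intros; simp)+)

lemma smooth_bend [smooth_intros]: "smooth_on_open UNIV (bend l)"
  unfolding bend_def[abs_def] by (intro smooth_intros) auto

lemma smooth_q [smooth_intros]: "smooth_on_open UNIV (q l)"
proof -
  have "smooth_on_open UNIV (\<lambda>x. if i = j l then sg l i * d l * bend l x else sg l i * (x \<bullet> i - P l i))" for i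
    by (cases "i = j l") (simp_all, (intro smooth_intros; simp)+)
  then show ?thesis unfolding q_def[abs_def] by (intro smooth_intros) auto
qed

lemma smooth_a [smooth_intros]: "smooth_on_open UNIV (\<lambda>x. a (x \<bullet> b0))"
  unfolding a_def by (intro smooth_intros) auto

lemma smooth_th [smooth_intros]: "smooth_on_open UNIV (\<lambda>x. th (x \<bullet> b0))"
  unfolding th_def by (intro smooth_intros) auto

lemma smooth_cw [smooth_intros]: "smooth_on_open UNIV (\<lambda>x. cw l (x \<bullet> b0))"
  unfolding cw_def by (cases "even l") (simp_all, (intro smooth_intros; simp)+)

lemma smooth_vl [smooth_intros]: "smooth_on_open UNIV (vl l)"
  unfolding vl_def[abs_def] by (cases "even l") (simp_all, (intro smooth_intros; simp)+)

lemma smooth_tau: "smooth_on_open UNIV tau"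
  unfolding tau_def[abs_def] by (intro smooth_intros) auto

lemma smooth_E [smooth_intros]: "smooth_on_open UNIV E"
  unfolding E_def[abs_def] by (intro smooth_intros) auto

lemma smooth_w [smooth_intros]: "smooth_on_open UNIV w"
  unfolding w_def[abs_def] by (intro smooth_intros) auto

lemma smooth_V: "smooth_on_open UNIV V"
  unfolding V_def[abs_def] by (intro smooth_intros) auto

lemma continuous_zc: "continuous_on UNIV (zc l)"
  by (rule smooth_continuous_on[OF smooth_zc])

lemma continuous_q: "continuous_on UNIV (q l)"
  by (rule smooth_continuous_on[OF smooth_q])

lemma profile_neq_0: "z \<bullet> b0 = 0 \<Longrightarrow> prof z \<noteq> 0"
  by (rule tube_profile_neq_0[OF b0])

lemma inactive: "\<not> z \<bullet> z < 1/16 \<Longrightarrow> bump z = 0 \<and> plateau z = 0"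
  using bump_eq_0[of z] plateau_eq_0[of z] by auto

section \<open>The outer shell of the ball\<close>

lemma R_pos: "R > 0"
  by (simp add: R_def)

lemma near_norm:
  assumes "near c x" "c \<le> N" "\<bar>x \<bullet> b0\<bar> \<le> M + 3"
  shows "x \<bullet> x < R\<^sup>2 / 4"
proof -
  have "\<bar>x \<bullet> i\<bar> \<le> M + 3" if i: "i \<in> Basis" for i
  proof (cases "i = b0")
    case False
    then have i': "i \<in> Basis - {b0}" using i by blast
    then have "\<lfloor>x \<bullet> i + 1/2\<rfloor> = int (P c i)" using assms(1) by (simp add: near_def)
    then have "real (P c i) \<le> x \<bullet> i + 1/2" "x \<bullet> i + 1/2 < real (P c i) + 1" by linarith+
    moreover have "real (P c i) < M" using P_less[OF assms(2) i'] by simp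
    ultimately show ?thesis by linarith
  qed (use assms(3) in simp)
  then have "(\<Sum>i\<in>Basis. \<bar>x \<bullet> i\<bar>) \<le> (\<Sum>i\<in>(Basis::'a set). real M + 3)"
    by (intro sum_mono) simp
  then have "norm x \<le> R / 4"
    using norm_le_l1[of x] by (simp add: R_def)
  then have "(norm x)\<^sup>2 \<le> (R / 4)\<^sup>2" by (intro power_mono) auto
  then have "x \<bullet> x \<le> R\<^sup>2 / 16" by (simp add: power2_norm_eq_inner power_divide)
  moreover have "R\<^sup>2 > 0" using R_pos by simp
  ultimately show ?thesis by linarith
qed

lemma active_norm:
  assumes "l < N" "cw l (x \<bullet> b0) \<noteq> 0" "q l x \<bullet> q l x < 1/16"
  shows "x \<bullet> x < R\<^sup>2 / 4"
proof -
  have kap: "kap l (x \<bullet> b0) < 1" by (rule kap_less_1[OF assms(1,3)])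
  have "\<bar>x \<bullet> b0\<bar> \<le> M + 3"
  proof (cases "even l")
    case True
    then have "\<not> x \<bullet> b0 \<le> 5/4" using assms(2) a_eq_0[of "x \<bullet> b0"] by (auto simp: cw_def)
    moreover have "x \<bullet> b0 < M + 3"
      using kap True smooth_step_eq_1[of "x \<bullet> b0 - M - 2"] by (force simp: kap_def)
    ultimately show ?thesis by simp
  next
    case False
    then have "\<not> x \<bullet> b0 \<ge> 7/4" using assms(2) a_eq_1[of "x \<bullet> b0"] by (auto simp: cw_def)
    moreover have "x \<bullet> b0 > 0"
      using kap False smooth_step_eq_1[of "1 - x \<bullet> b0"] by (force simp: kap_def)
    ultimately show ?thesis by simp
  qed
  moreover obtain c where "near c x" "c \<le> N"
    using near_q[OF assms(1,3)] assms(1) by auto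
  ultimately show ?thesis using near_norm by blast
qed

lemma outer_link:
  assumes "x \<bullet> x \<ge> R\<^sup>2 / 4" "l < N"
  shows "cw l (x \<bullet> b0) * plateau (q l x) = 0" "cw l (x \<bullet> b0) * bump (q l x) = 0"
  using active_norm[OF assms(2), of x] inactive[of "q l x"] assms(1) by force+

lemma outer_tau: "x \<bullet> x \<ge> R\<^sup>2 / 4 \<Longrightarrow> tau x = 1"
  unfolding tau_def by (subst sum.neutral) (auto simp: outer_link(1))

lemma outer_E:
  assumes "x \<bullet> x \<ge> R\<^sup>2 / 4"
  shows "E x = b0 + ((1 - a (x \<bullet> b0)) * bump (zc 0 x)) *\<^sub>R (zc 0 x - 2 *\<^sub>R b0)"
proof -
  have "(cw l (x \<bullet> b0) * bump (q l x)) *\<^sub>R (q l x - 2 *\<^sub>R b0) = 0" if "l < N - 1" for l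
    using outer_link(2)[OF assms, of l] that by simp
  then have "(\<Sum>l<N - 1. (cw l (x \<bullet> b0) * bump (q l x)) *\<^sub>R (q l x - 2 *\<^sub>R b0)) = 0"
    by (intro sum.neutral) auto
  then show ?thesis by (simp add: E_def)
qed

lemma zc_0: "zc 0 x = x - (x \<bullet> b0) *\<^sub>R b0"
proof (rule euclidean_eqI)
  fix i :: 'a assume i: "i \<in> Basis"
  show "zc 0 x \<bullet> i = (x - (x \<bullet> b0) *\<^sub>R b0) \<bullet> i"
  proof (cases "i = b0")
    case True
    then show ?thesis using zc_inner_b0 b0 by (simp add: inner_diff_left)
  next
    case False
    then show ?thesis
      using i zc_inner[of i 0 x] b0 by (simp add: inner_diff_left P0 sg_def inner_not_same_Basis)
  qed
qed

lemma w_bounds: "0 \<le> w x" "w x \<le> 1"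
  by (simp_all add: w_def smooth_step_nonneg smooth_step_le_1)

lemma w_eq_1: "x \<bullet> x \<le> 3/4 * R\<^sup>2 \<Longrightarrow> w x = 1"
  unfolding w_def using R_pos by (intro smooth_step_eq_1) (simp add: field_simps)

lemma w_eq_0: "x \<bullet> x = R\<^sup>2 \<Longrightarrow> w x = 0"
  unfolding w_def using R_pos by (intro smooth_step_eq_0) (simp add: field_simps)

text \<open>The vectors \<open>x\<close> and \<open>E x\<close> do not point in opposite directions
  here. Off the axis of \<open>b0\<close> the component orthogonal to \<open>b0\<close> vanishes
  only if \<open>w x = 1\<close> and \<open>f = 0\<close>, and then the component along
  \<open>b0\<close> is 1. On the axis \<open>E x\<close> is \<open>b0\<close> above and
  \<open>- b0\<close> below, on the same side as \<open>x\<close>.\<close>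

lemma outer_V:
  assumes x: "x \<bullet> x \<ge> R\<^sup>2 / 4"
  shows "V x \<noteq> 0"
proof
  assume 0: "V x = 0"
  define s where "s = x \<bullet> b0"
  define y where "y = zc 0 x"
  define f where "f = (1 - a s) * bump y"
  have x_eq: "x = y + s *\<^sub>R b0" by (simp add: y_def s_def zc_0)
  have y_b0: "y \<bullet> b0 = 0" by (simp add: y_def zc_inner_b0)
  have b0b0: "b0 \<bullet> b0 = 1" using b0 by simp
  have V: "V x = ((1 - w x) + w x * f) *\<^sub>R y + ((1 - w x) * s + w x * (1 - 2 * f)) *\<^sub>R b0"
    unfolding V_def outer_E[OF x] y_def[symmetric] s_def[symmetric] f_def[symmetric]
    by (subst (2) x_eq) (simp add: algebra_simps flip: scaleR_2)
  have "V x \<bullet> y = ((1 - w x) + w x * f) * (y \<bullet> y)"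
    using y_b0 by (simp add: V inner_left_distrib inner_commute[of b0])
  then have Vy: "((1 - w x) + w x * f) * (y \<bullet> y) = 0" using 0 by simp
  have "V x \<bullet> b0 = (1 - w x) * s + w x * (1 - 2 * f)"
    using y_b0 b0b0 by (simp add: V inner_left_distrib)
  then have Vb: "(1 - w x) * s + w x * (1 - 2 * f) = 0" using 0 by simp
  have f: "f \<ge> 0" using a_bounds[of s] bump_nonneg[of y] by (simp add: f_def)
  note w = w_bounds[of x]
  define p where "p = (1 - w x) * s"
  show False
  proof (cases "y = 0")
    case True
    then have "x \<bullet> x = s\<^sup>2" using x_eq b0b0 by (simp add: power2_eq_square)
    \<comment> \<open>This gives \<open>\<bar>s\<bar> \<ge> 2\<close> on the axis, outside the range
      from 5/4 to 7/4 in which \<open>a\<close> varies.\<close>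
    moreover have "R \<ge> 4"
    proof -
      have "real 1 * 1 \<le> real DIM('a) * (real M + 3)"
        by (intro mult_mono) (auto simp: Suc_leI)
      then show ?thesis by (simp add: R_def)
    qed
    ultimately have "s\<^sup>2 \<ge> 2\<^sup>2" using x power_mono[of 4 R 2] by simp
    then have "\<bar>s\<bar> \<ge> 2" using abs_le_square_iff[of 2 s] by simp
    then consider "s \<ge> 2" | "s \<le> - 2" by linarith
    then show False
    proof cases
      case 1
      then have "f = 0" using a_eq_1[of s] by (simp add: f_def)
      then have *: "p + w x = 0" using Vb by (simp add: p_def)
      have "p \<ge> (1 - w x) * 2" unfolding p_def using w 1 by (intro mult_left_mono) auto
      then show False using * w by simp
    next
      case 2
      then have "f = 1" using a_eq_0[of s] True bump_0[where 'a = 'a] by (simp add: f_def)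
      then have *: "p - w x = 0" using Vb by (simp add: p_def)
      have "p \<le> (1 - w x) * (- 2)" unfolding p_def using w 2 by (intro mult_left_mono) auto
      then show False using * w by simp
    qed
  next
    case False
    then have "(1 - w x) + w x * f = 0" using Vy by simp
    moreover have "w x * f \<ge> 0" using w f by simp
    ultimately have "w x = 1" "w x * f = 0" using w by linarith+
    then have "w x = 1" "f = 0" by auto
    then show False using Vb by simp
  qed
qed

section \<open>Values of \<open>tau\<close> and \<open>E\<close> along the tube\<close>

lemma single_link:
  assumes l: "l < N - 1" and act: "q l x \<bullet> q l x < 1/64"
    and zone: "(even l \<and> x \<bullet> b0 \<ge> 7/4) \<or> (odd l \<and> x \<bullet> b0 \<le> 5/4)"
  shows "tau x = 1 - vl l x / N" "E x = prof (q l x)"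
proof -
  have lN: "l < N" using l by simp
  have act': "q l x \<bullet> q l x < 1/16" using act by simp
  have cw1: "cw l (x \<bullet> b0) = 1"
    using zone a_eq_0[of "x \<bullet> b0"] a_eq_1[of "x \<bullet> b0"] by (auto simp: cw_def)
  \<comment> \<open>Links of the same parity are excluded by uniqueness of the active link, those of
    the other parity by their weight at this height.\<close>
  have other: "cw k (x \<bullet> b0) = 0 \<or> (plateau (q k x) = 0 \<and> bump (q k x) = 0)" if "k < N" "k \<noteq> l" for k
  proof (cases "even k = even l")
    case True
    then have "\<not> q k x \<bullet> q k x < 1/16" using q_active_unique[OF that(1) lN _ act'] that(2) by blast
    then show ?thesis using inactive by blast
  next
    case False
    then show ?thesis
      using zone a_eq_0[of "x \<bullet> b0"] a_eq_1[of "x \<bullet> b0"] by (auto simp: cw_def)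
  qed
  have "(\<Sum>k<N. cw k (x \<bullet> b0) * plateau (q k x) * vl k x) = cw l (x \<bullet> b0) * plateau (q l x) * vl l x"
    using lN other by (intro sum_eq_single) auto
  then show "tau x = 1 - vl l x / N"
    using cw1 plateau_eq_1[of "q l x"] act by (simp add: tau_def)
  have "(\<Sum>k<N - 1. (cw k (x \<bullet> b0) * bump (q k x)) *\<^sub>R (q k x - 2 *\<^sub>R b0))
      = (cw l (x \<bullet> b0) * bump (q l x)) *\<^sub>R (q l x - 2 *\<^sub>R b0)"
  proof (intro sum_eq_single)
    fix k assume "k \<in> {..<N - 1}" "k \<noteq> l"
    then show "(cw k (x \<bullet> b0) * bump (q k x)) *\<^sub>R (q k x - 2 *\<^sub>R b0) = 0"
      using other[of k] by auto
  qed (use l in auto)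
  moreover have "(1 - a (x \<bullet> b0)) * bump (zc 0 x) = 0"
  proof (cases "even l")
    case True
    then show ?thesis using zone a_eq_1[of "x \<bullet> b0"] by auto
  next
    case False
    then have "\<not> near 0 x"
      using q_active_near[OF lN act', of 0] by (cases l) auto
    then show ?thesis using near_zc[of 0 x] inactive[of "zc 0 x"] by auto
  qed
  ultimately show "E x = prof (q l x)"
    using cw1 by (simp add: E_def tube_profile_def)
qed

lemma first_cell:
  assumes act: "zc 0 x \<bullet> zc 0 x < 1/64" and s: "x \<bullet> b0 \<le> 5/4"
  shows "tau x = 1" "E x = prof (zc 0 x)"
proof -
  have near: "near 0 x" using act by (intro near_zc) simp
  have other: "cw k (x \<bullet> b0) = 0 \<or> (plateau (q k x) = 0 \<and> bump (q k x) = 0)" if "k < N" for k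
  proof (cases "even k")
    case True
    then show ?thesis using s a_eq_0[of "x \<bullet> b0"] by (auto simp: cw_def)
  next
    case False
    then have "\<not> q k x \<bullet> q k x < 1/16" using q_active_near[OF that _ near] by (cases k) auto
    then show ?thesis using inactive by blast
  qed
  have "cw k (x \<bullet> b0) * plateau (q k x) * vl k x = 0" if "k < N" for k using other[OF that] by auto
  then have "(\<Sum>k<N. cw k (x \<bullet> b0) * plateau (q k x) * vl k x) = 0" by (intro sum.neutral) auto
  then show "tau x = 1" by (simp add: tau_def)
  have "(cw k (x \<bullet> b0) * bump (q k x)) *\<^sub>R (q k x - 2 *\<^sub>R b0) = 0" if "k < N - 1" for k
    using other[of k] that by auto
  then have "(\<Sum>k<N - 1. (cw k (x \<bullet> b0) * bump (q k x)) *\<^sub>R (q k x - 2 *\<^sub>R b0)) = 0"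
    by (intro sum.neutral) auto
  then show "E x = prof (zc 0 x)"
    using a_eq_0[OF s] by (simp add: E_def tube_profile_def)
qed

text \<open>Here both links at the cell see the same coordinates \<open>zc c x\<close> and the same
  value of \<open>vl\<close>, so weights with sum 1 blend identical data. At \<open>c = 0\<close>
  the entrance term of \<open>E\<close> supplies the weight of the missing lower link. At
  \<open>c = N - 1\<close> nothing does, which is why the claim about \<open>E\<close> excludes that
  cell.\<close>

lemma crossing_zone:
  assumes c: "c < N" and act: "zc c x \<bullet> zc c x < 1/64" and s: "1 \<le> x \<bullet> b0" "x \<bullet> b0 \<le> 2"
  shows "tau x = 1 - real (2 * (Suc c div 2)) / N" "c < N - 1 \<Longrightarrow> E x = prof (zc c x)"
proof -
  have act': "zc c x \<bullet> zc c x < 1/16" using act by simp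
  have near: "near c x" by (rule near_zc[OF act'])
  have kap: "kap k (x \<bullet> b0) = 0" for k using s kap_eq_0[of "x \<bullet> b0" k] by simp
  have th: "th (x \<bullet> b0) = 0" by (rule th_eq_0) (use s in auto)
  have ql: "q c x = zc c x" and ul: "smooth_sgn (u c x) = - 1"
    using q_eq_zc[OF c kap] u_le_of_zc[OF c act'] smooth_sgn_neg by blast+
  have qr: "q (c - 1) x = zc c x" and ur: "smooth_sgn (u (c - 1) x) = 1" if "c \<ge> 1"
  proof -
    have c': "c - 1 < N" "Suc (c - 1) = c" using that c by auto
    show "q (c - 1) x = zc c x" "smooth_sgn (u (c - 1) x) = 1"
      using q_eq_zc_Suc[OF c'(1) kap] u_ge_of_zc_Suc[OF c'(1)] act' smooth_sgn_pos unfolding c'(2) by blast+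
  qed
  have chi: "plateau (zc c x) = 1" using act by (intro plateau_eq_1) simp
  have other: "plateau (q k x) = 0 \<and> bump (q k x) = 0" if "k < N" "k \<noteq> c" "Suc k \<noteq> c" for k
    using q_active_near[OF that(1) _ near] that c inactive[of "q k x"] by fastforce
  define A where "A = a (x \<bullet> b0)"
  have "(\<Sum>k<N. cw k (x \<bullet> b0) * plateau (q k x) * vl k x)
      = (if c < N then cw c (x \<bullet> b0) * plateau (q c x) * vl c x else 0)
        + (if c \<ge> 1 then cw (c - 1) (x \<bullet> b0) * plateau (q (c - 1) x) * vl (c - 1) x else 0)"
    using other c by (intro sum_eq_two) auto
  also have "\<dots> = real (2 * (Suc c div 2))"
  proof (cases "even c")
    case True
    then have div: "Suc c div 2 = c div 2" by (simp add: even_Suc_div_two)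
    show ?thesis
    proof (cases "c = 0")
      case True
      then show ?thesis using c ul ql chi th by (simp add: vl_def)
    next
      case False
      then have "odd (c - 1)" using \<open>even c\<close> by simp
      then show ?thesis
        using False \<open>even c\<close> c ql ul qr ur chi th div
        by (simp add: vl_def cw_def A_def[symmetric] of_nat_diff algebra_simps flip: of_nat_mult)
    qed
  next
    case False
    then have "2 * (Suc c div 2) = Suc c" "c \<ge> 1" "even (c - 1)" by (auto elim!: oddE)
    then show ?thesis
      using False c ql ul qr ur chi th
      by (simp add: vl_def cw_def A_def[symmetric] of_nat_diff algebra_simps)
  qed
  finally show "tau x = 1 - real (2 * (Suc c div 2)) / N" by (simp add: tau_def)
  assume c1: "c < N - 1"
  define e where "e = bump (zc c x) *\<^sub>R (zc c x - 2 *\<^sub>R b0)"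
  have "(\<Sum>k<N - 1. (cw k (x \<bullet> b0) * bump (q k x)) *\<^sub>R (q k x - 2 *\<^sub>R b0))
      = (if c < N - 1 then (cw c (x \<bullet> b0) * bump (q c x)) *\<^sub>R (q c x - 2 *\<^sub>R b0) else 0)
        + (if c \<ge> 1 then (cw (c - 1) (x \<bullet> b0) * bump (q (c - 1) x)) *\<^sub>R (q (c - 1) x - 2 *\<^sub>R b0) else 0)"
    using other c1 by (intro sum_eq_two) auto
  also have "\<dots> = (if c = 0 then A *\<^sub>R e else e)"
  proof (cases "c = 0")
    case True
    then show ?thesis using c1 ql by (simp add: cw_def A_def e_def)
  next
    case False
    then have "cw c (x \<bullet> b0) + cw (c - 1) (x \<bullet> b0) = 1" by (cases "even c") (auto simp: cw_def)
    then have "cw c (x \<bullet> b0) *\<^sub>R e + cw (c - 1) (x \<bullet> b0) *\<^sub>R e = e"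
      by (metis scaleR_left_distrib scaleR_one)
    then show ?thesis using False c1 ql qr by (simp add: e_def)
  qed
  finally have sum: "(\<Sum>k<N - 1. (cw k (x \<bullet> b0) * bump (q k x)) *\<^sub>R (q k x - 2 *\<^sub>R b0))
      = (if c = 0 then A *\<^sub>R e else e)" .
  show "E x = prof (zc c x)"
  proof (cases "c = 0")
    case True
    have first: "((1 - a (x \<bullet> b0)) * bump (zc 0 x)) *\<^sub>R (zc 0 x - 2 *\<^sub>R b0) = (1 - A) *\<^sub>R e"
      using True by (simp add: A_def e_def)
    have "E x = b0 + ((1 - A) *\<^sub>R e + A *\<^sub>R e)"
      unfolding E_def sum first using True by simp
    also have "(1 - A) *\<^sub>R e + A *\<^sub>R e = e"
      by (simp flip: scaleR_left_distrib)
    finally show ?thesis using True by (simp add: tube_profile_def e_def)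
  next
    case False
    then have "bump (zc 0 x) = 0"
      using near_zc[of 0 x] near_unique[OF near, of 0] c inactive[of "zc 0 x"] by fastforce
    then show ?thesis unfolding E_def sum using False by (simp add: e_def tube_profile_def)
  qed
qed


section \<open>Local behaviour of \<open>tau\<close> and \<open>V\<close>\<close>

lemma eventually_continuous_less:
  fixes f g :: "'a \<Rightarrow> real"
  assumes "continuous_on UNIV f" "continuous_on UNIV g" "f x < g x"
  shows "\<forall>\<^sub>F y in nhds x. f y < g y"
proof -
  have "open {y. f y < g y}" by (rule open_Collect_less[OF assms(1,2)])
  then show ?thesis using assms(3) eventually_nhds by blast
qed

lemma eventually_zc:
  assumes "zc c x \<bullet> zc c x < 1/64"
  shows "\<forall>\<^sub>F y in nhds x. zc c y \<bullet> zc c y < 1/64"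
  using assms by (intro eventually_continuous_less continuous_intros continuous_zc)

lemma eventually_q:
  assumes "q l x \<bullet> q l x < 1/64"
  shows "\<forall>\<^sub>F y in nhds x. q l y \<bullet> q l y < 1/64"
  using assms by (intro eventually_continuous_less continuous_intros continuous_q)

lemma eventually_less_b0: "x \<bullet> b0 < s \<Longrightarrow> \<forall>\<^sub>F y in nhds x. y \<bullet> b0 < s"
  by (intro eventually_continuous_less continuous_intros)

lemma eventually_greater_b0: "x \<bullet> b0 > s \<Longrightarrow> \<forall>\<^sub>F y in nhds x. y \<bullet> b0 > s"
  by (intro eventually_continuous_less continuous_intros)

lemma has_derivative_eventually_eq:
  assumes "\<forall>\<^sub>F y in nhds x. f y = g y" "(g has_derivative D) (at x)"
  shows "(f has_derivative D) (at x)"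
proof -
  have "\<forall>\<^sub>F y in at x. g y = f y"
    using assms(1) by (auto simp: eventually_at_filter elim: eventually_mono)
  then show ?thesis
    using has_derivative_transform_eventually[OF assms(2)] eventually_nhds_x_imp_x[OF assms(1)] by auto
qed

lemma th_has_derivative:
  "((\<lambda>y. th (y \<bullet> b0)) has_derivative
     (\<lambda>v. (v \<bullet> b0) / M * frechet_derivative smooth_step (at ((x \<bullet> b0 - 2) / M)) 1)) (at x)"
proof -
  let ?D = "frechet_derivative smooth_step (at ((x \<bullet> b0 - 2) / M))"
  have D: "(smooth_step has_derivative ?D) (at ((x \<bullet> b0 - 2) / M))"
    by (rule smooth_has_derivative[OF smooth_smooth_step UNIV_I])
  have "((\<lambda>y. (y \<bullet> b0 - 2) / M) has_derivative (\<lambda>v. (v \<bullet> b0) / M)) (at x)"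
    using M by (auto intro!: derivative_eq_intros)
  from has_derivative_compose[OF this D]
  have "((\<lambda>y. th (y \<bullet> b0)) has_derivative (\<lambda>v. ?D ((v \<bullet> b0) / M))) (at x)"
    by (simp add: th_def)
  moreover have "(\<lambda>v. ?D ((v \<bullet> b0) / M)) = (\<lambda>v. (v \<bullet> b0) / M * ?D 1)"
  proof
    show "?D ((v \<bullet> b0) / M) = (v \<bullet> b0) / M * ?D 1" for v
      using linear_cmul[OF has_derivative_linear[OF D], of "(v \<bullet> b0) / M" 1] by simp
  qed
  ultimately show ?thesis by (rule has_derivative_eq_rhs)
qed

lemma eventually_inner:
  assumes "x \<bullet> x \<le> R\<^sup>2 / 4"
  shows "\<forall>\<^sub>F y in nhds x. V y = E y"
proof -
  have "R\<^sup>2 > 0" using R_pos by simp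
  then have "x \<bullet> x < 3/4 * R\<^sup>2" using assms by linarith
  then have "\<forall>\<^sub>F y in nhds x. y \<bullet> y < 3/4 * R\<^sup>2"
    by (intro eventually_continuous_less continuous_intros)
  then show ?thesis
    by eventually_elim (simp add: V_def w_eq_1)
qed

text \<open>In the first three cases the differential of the final map has rank at most
  \<open>2 * n\<close>; the last one is the slow descent on a straight piece. Only the third case
  admits \<open>V x = 0\<close>, since profiles do not vanish, so around the zeros of
  \<open>V\<close> the factor \<open>tau\<close> vanishes identically.\<close>

lemma derivative_cases:
  assumes C: "\<And>t. \<bar>frechet_derivative smooth_step (at t) 1\<bar> \<le> C"
  obtains "V x \<noteq> 0" "(tau has_derivative (\<lambda>_. 0)) (at x)"
  | "V x \<noteq> 0" "(V has_derivative (\<lambda>_. 0)) (at x)"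
  | "\<forall>\<^sub>F y in nhds x. tau y = 0"
  | c D where "zc c x \<bullet> zc c x \<le> 1" "\<forall>\<^sub>F y in nhds x. V y = prof (zc c y)" "\<bar>tau x\<bar> \<le> 1"
      "(tau has_derivative D) (at x)" "\<And>v. \<bar>D v\<bar> \<le> C / (real M * real N) * norm v"
proof (cases "x \<bullet> x > R\<^sup>2 / 4")
  case True
  then have "\<forall>\<^sub>F y in nhds x. R\<^sup>2 / 4 < y \<bullet> y"
    by (intro eventually_continuous_less continuous_intros)
  then have "\<forall>\<^sub>F y in nhds x. tau y = 1"
    by eventually_elim (simp add: outer_tau)
  from has_derivative_eventually_eq[OF this has_derivative_const] show thesis
    using that(1) outer_V[of x] True by simp
next
  case False
  note alt = that
  have VE: "\<forall>\<^sub>F y in nhds x. V y = E y"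
    using False by (intro eventually_inner) simp
  have VEx: "V x = E x" using VE by (rule eventually_nhds_x_imp_x)
  have const: thesis if "\<forall>\<^sub>F y in nhds x. tau y = t" "E x = prof z" "z \<bullet> b0 = 0" for t z
    using alt(1) has_derivative_eventually_eq[OF that(1) has_derivative_const]
      profile_neq_0[OF that(3)] that(2) VEx by simp
  let ?s = "x \<bullet> b0"
  have crossing: thesis if c: "c < N" "zc c x \<bullet> zc c x < 1/64" "1 < ?s" "?s < 2" for c
  proof -
    have ev: "\<forall>\<^sub>F y in nhds x. tau y = 1 - real (2 * (Suc c div 2)) / N"
      using eventually_zc[OF c(2)] eventually_greater_b0[OF c(3)] eventually_less_b0[OF c(4)]
      by eventually_elim (rule crossing_zone(1)[OF c(1)], auto)
    show thesis
    proof (cases "c = N - 1")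
      case True
      \<comment> \<open>The tube ends here: as \<open>N\<close> is even, the division loses nothing
        and \<open>tau\<close> has come down to 0, just where \<open>E\<close> lacks its lower link
        and may vanish.\<close>
      then have "Suc c = N" using N(2) by simp
      then have "2 * (Suc c div 2) = N" using N(1) by simp
      then have "\<forall>\<^sub>F y in nhds x. tau y = 0" using ev N(2) by simp
      then show thesis by (rule alt(3))
    next
      case False
      then have "E x = prof (zc c x)"
        using c by (intro crossing_zone(2)[OF c(1,2)]) auto
      then show thesis using const[OF ev] zc_inner_b0 by blast
    qed
  qed
  consider (none) "(1 - a ?s) * bump (zc 0 x) = 0" "\<forall>l<N - 1. cw l ?s * bump (q l x) = 0"
    | (first) "(1 - a ?s) * bump (zc 0 x) \<noteq> 0"
    | (link) l where "l < N - 1" "cw l ?s * bump (q l x) \<noteq> 0"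
    by blast
  then show thesis
  proof cases
    case none
    have z: "((\<lambda>y. ((1 - a (y \<bullet> b0)) * bump (zc 0 y)) *\<^sub>R (zc 0 y - 2 *\<^sub>R b0)) has_derivative (\<lambda>_. 0)) (at x)"
    proof (rule has_derivative_zero_at_zero)
      show "0 \<le> (1 - a (y \<bullet> b0)) * bump (zc 0 y)" for y
        using a_bounds(2)[of "y \<bullet> b0"] bump_nonneg[of "zc 0 y"] by simp
    qed (use none(1) in \<open>auto intro!: smooth_intros\<close>)
    have l: "((\<lambda>y. (cw l (y \<bullet> b0) * bump (q l y)) *\<^sub>R (q l y - 2 *\<^sub>R b0)) has_derivative (\<lambda>_. 0)) (at x)"
      if "l < N - 1" for l
    proof (rule has_derivative_zero_at_zero)
      show "0 \<le> cw l (y \<bullet> b0) * bump (q l y)" for y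
        using cw_nonneg[of l "y \<bullet> b0"] bump_nonneg[of "q l y"] by simp
    qed (use none(2) that in \<open>auto intro!: smooth_intros\<close>)
    have "(E has_derivative (\<lambda>v. 0 + 0 + (\<Sum>l<N - 1. 0))) (at x)"
      unfolding E_def[abs_def] using l
      by (intro has_derivative_add has_derivative_const z has_derivative_sum) auto
    then have "(V has_derivative (\<lambda>v. 0)) (at x)"
      using has_derivative_eventually_eq[OF VE] by simp
    moreover have "E x = b0"
    proof -
      have "(\<Sum>l<N - 1. (cw l ?s * bump (q l x)) *\<^sub>R (q l x - 2 *\<^sub>R b0)) = 0"
        by (intro sum.neutral) (use none(2) in auto)
      then show ?thesis unfolding E_def using none(1) by simp
    qed
    then have "V x \<noteq> 0" using VEx b0 nonzero_Basis by auto
    ultimately show thesis using alt(2) by blast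
  next
    case first
    then have z: "zc 0 x \<bullet> zc 0 x < 1/64" and a1: "a ?s \<noteq> 1"
      using bump_eq_0[of "zc 0 x"] by force+
    have s: "?s < 7/4" using a1 a_eq_1[of ?s] by force
    show thesis
    proof (cases "?s < 5/4")
      case True
      have "\<forall>\<^sub>F y in nhds x. tau y = 1"
        using eventually_zc[OF z] eventually_less_b0[OF True]
        by eventually_elim (rule first_cell(1), auto)
      then show thesis
        using const first_cell(2)[OF z] True zc_inner_b0 by force
    next
      case False
      then show thesis using crossing[OF _ z] s N(2) by simp
    qed
  next
    case link
    have lN: "l < N" using link(1) by simp
    have z: "q l x \<bullet> q l x < 1/64" and cw: "cw l ?s \<noteq> 0"
      using link(2) bump_eq_0[of "q l x"] by force+
    have z': "q l x \<bullet> q l x < 1/16" using z by simp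
    consider "?s < 5/4" | "5/4 \<le> ?s" "?s \<le> 7/4" | "?s > 7/4" by linarith
    then show thesis
    proof cases
      case 1
      then have odd: "odd l" using cw a_eq_0[of ?s] by (auto simp: cw_def)
      have "\<forall>\<^sub>F y in nhds x. tau y = 1 - (l + 1) / N"
        using eventually_q[OF z] eventually_less_b0[OF 1]
      proof eventually_elim
        case (elim y)
        then show ?case
          using single_link(1)[OF link(1), of y] odd th_eq_0[of "y \<bullet> b0"] by (simp add: vl_def)
      qed
      then show thesis
        using const single_link(2)[OF link(1) z] 1 odd q_inner_b0 by force
    next
      case 2
      have kap: "kap l ?s = 0" using 2 by (intro kap_eq_0) auto
      obtain c where "c < N" "q l x = zc c x"
        using q_cases[OF lN kap z'] link(1) lN by (metis Suc_less_eq2 less_diff_conv Suc_eq_plus1)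
      then show thesis using crossing[of c] z 2 by simp
    next
      case 3
      then have even: "even l" using cw a_eq_1[of ?s] by (auto simp: cw_def split: if_splits)
      have ev: "\<forall>\<^sub>F y in nhds x. tau y = 1 - (l + 1 + smooth_sgn (u l y) * (1 - th (y \<bullet> b0))) / N \<and>
          E y = prof (q l y)"
        using eventually_q[OF z] eventually_greater_b0[OF 3]
      proof eventually_elim
        case (elim y)
        then show ?case
          using single_link[OF link(1), of y] even by (simp add: vl_def)
      qed
      have affine: "((\<lambda>y. 1 - (l + 1 + p y) / N) has_derivative (\<lambda>v. - (D v / N))) (at x)"
        if "(p has_derivative D) (at x)" for p D :: "'a \<Rightarrow> real"
        using that N(2) by (auto intro!: derivative_eq_intros)
      have Ex: "E x = prof (q l x)" using eventually_nhds_x_imp_x[OF ev] by simp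
      show thesis
      proof (cases "?s < M + 2")
        case False
        \<comment> \<open>At height \<open>M + 2\<close> itself \<open>th\<close> need not be
          constant nearby; stationarity comes from the minimum of \<open>1 - th\<close>. The same
          argument removes the variation of \<open>smooth_sgn\<close> in the bend.\<close>
        have "((\<lambda>y. (1 - th (y \<bullet> b0)) *\<^sub>R smooth_sgn (u l y)) has_derivative (\<lambda>_. 0)) (at x)"
          using False th_eq_1[of ?s] th_bounds
          by (intro has_derivative_zero_at_zero) (auto intro!: smooth_intros)
        then have "((\<lambda>y. smooth_sgn (u l y) * (1 - th (y \<bullet> b0))) has_derivative (\<lambda>_. 0)) (at x)"
          by (simp add: mult.commute)
        from affine[OF this]
        have D0: "((\<lambda>y. 1 - (l + 1 + smooth_sgn (u l y) * (1 - th (y \<bullet> b0))) / N) has_derivative (\<lambda>_. 0)) (at x)"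
          by simp
        have ev0: "\<forall>\<^sub>F y in nhds x. tau y = 1 - (l + 1 + smooth_sgn (u l y) * (1 - th (y \<bullet> b0))) / N"
          using ev by eventually_elim simp
        have "(tau has_derivative (\<lambda>_. 0)) (at x)"
          by (rule has_derivative_eventually_eq[OF ev0 D0])
        then show thesis
          using alt(1) VEx Ex profile_neq_0[OF q_inner_b0] by simp
      next
        case True
        have kap_ev: "\<forall>\<^sub>F y in nhds x. kap l (y \<bullet> b0) = 0"
          using eventually_greater_b0[OF 3] eventually_less_b0[OF True]
          by eventually_elim (rule kap_eq_0, auto)
        have "\<exists>c \<rho>. q l x = zc c x \<and> (\<rho> = 1 \<or> \<rho> = - 1) \<and>
            (\<forall>\<^sub>F y in nhds x. q l y = zc c y \<and> smooth_sgn (u l y) = \<rho>)"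
          using lN eventually_nhds_x_imp_x[OF kap_ev] z'
        proof (cases rule: q_cases)
          case 1
          have "\<forall>\<^sub>F y in nhds x. u l y < - 1/8"
            using 1(1) by (intro eventually_continuous_less smooth_continuous_on[OF smooth_u] continuous_intros)
          with kap_ev have "\<forall>\<^sub>F y in nhds x. q l y = zc l y \<and> smooth_sgn (u l y) = - 1"
            by eventually_elim (use q_eq_zc[OF lN] smooth_sgn_neg in auto)
          then show ?thesis using 1(2) by blast
        next
          case 2
          have "\<forall>\<^sub>F y in nhds x. 1/8 < u l y"
            using 2(1) by (intro eventually_continuous_less smooth_continuous_on[OF smooth_u] continuous_intros)
          with kap_ev have "\<forall>\<^sub>F y in nhds x. q l y = zc (Suc l) y \<and> smooth_sgn (u l y) = 1"
            by eventually_elim (use q_eq_zc_Suc[OF lN] smooth_sgn_pos in auto)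
          then show ?thesis using 2(2) by blast
        qed
        then obtain c \<rho> where c: "q l x = zc c x" "\<rho> = 1 \<or> \<rho> = - 1"
            "\<forall>\<^sub>F y in nhds x. q l y = zc c y \<and> smooth_sgn (u l y) = \<rho>"
          by blast
        define D where "D v = \<rho> / N * ((v \<bullet> b0) / M * frechet_derivative smooth_step (at ((x \<bullet> b0 - 2) / M)) 1)" for v
        have ev_tau: "\<forall>\<^sub>F y in nhds x. tau y = 1 - (l + 1 + \<rho> * (1 - th (y \<bullet> b0))) / N"
          using ev c(3) by eventually_elim simp
        have "((\<lambda>y. 1 - (l + 1 + \<rho> * (1 - th (y \<bullet> b0))) / N) has_derivative D) (at x)"
        proof -
          have "((\<lambda>y. \<rho> * (1 - th (y \<bullet> b0))) has_derivative
              (\<lambda>v. \<rho> * (0 - (v \<bullet> b0) / M * frechet_derivative smooth_step (at ((x \<bullet> b0 - 2) / M)) 1))) (at x)"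
            by (intro has_derivative_mult_right has_derivative_diff has_derivative_const th_has_derivative)
          from affine[OF this] show ?thesis
            by (rule has_derivative_eq_rhs) (simp add: D_def fun_eq_iff)
        qed
        then have D: "(tau has_derivative D) (at x)"
          by (rule has_derivative_eventually_eq[OF ev_tau])
        have "\<bar>D v\<bar> \<le> C / (real M * real N) * norm v" for v
        proof -
          have "\<bar>v \<bullet> b0\<bar> * \<bar>frechet_derivative smooth_step (at ((x \<bullet> b0 - 2) / M)) 1\<bar> \<le> norm v * C"
            using C Basis_le_norm[OF b0] by (intro mult_mono) auto
          then have "(\<bar>v \<bullet> b0\<bar> * \<bar>frechet_derivative smooth_step (at ((x \<bullet> b0 - 2) / M)) 1\<bar>) / (real M * real N)
              \<le> norm v * C / (real M * real N)"
            by (intro divide_right_mono) auto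
          moreover have "\<bar>\<rho>\<bar> = 1" using c(2) by auto
          ultimately show ?thesis by (simp add: D_def abs_mult mult_ac)
        qed
        moreover have "\<bar>tau x\<bar> \<le> 1"
        proof -
          have "real l + 2 \<le> N" using link(1) by linarith
          moreover have "0 \<le> 1 + \<rho> * (1 - th ?s)" "1 + \<rho> * (1 - th ?s) \<le> 2"
            using c(2) th_bounds[of ?s] by auto
          ultimately have "0 \<le> (l + 1 + \<rho> * (1 - th ?s)) / N" "(l + 1 + \<rho> * (1 - th ?s)) / N \<le> 1"
            using N(2) by (auto simp: divide_le_eq_1)
          then show ?thesis using eventually_nhds_x_imp_x[OF ev_tau] by simp
        qed
        moreover have "\<forall>\<^sub>F y in nhds x. V y = prof (zc c y)"
          using VE ev c(3) by eventually_elim simp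
        ultimately show thesis using alt(4)[of c D] D z' c(1) by simp
      qed
    qed
  qed
qed


lemma zc_has_derivative:
  obtains \<Lambda> where "(zc c has_derivative \<Lambda>) (at x)" "\<And>v. norm (\<Lambda> v) \<le> DIM('a) * norm v"
proof
  let ?\<Lambda> = "\<lambda>v. \<Sum>i\<in>Basis - {b0}. (sg c i * (v \<bullet> i)) *\<^sub>R i"
  show "(zc c has_derivative ?\<Lambda>) (at x)"
    unfolding zc_def[abs_def]
    by (intro has_derivative_sum) (auto intro!: derivative_eq_intros)
  show "norm (?\<Lambda> v) \<le> DIM('a) * norm v" for v
  proof -
    have "norm (?\<Lambda> v) \<le> (\<Sum>i\<in>Basis - {b0}. norm v)"
      by (rule sum_norm_le) (auto simp: abs_mult Basis_le_norm)
    also have "\<dots> \<le> (\<Sum>i\<in>(Basis::'a set). norm v)"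
      by (rule sum_mono2) auto
    finally show ?thesis by simp
  qed
qed

end

section \<open>Existence of the tube\<close>

lemma snake_exists:
  assumes b0: "b0 \<in> (Basis :: 'a::euclidean_space set)" and M: "odd M" "M \<ge> 3" and dim: "DIM('a) \<ge> 2"
  shows "\<exists>P j d. snake b0 M (M ^ (DIM('a) - 1) - 1) P j d"
proof -
  let ?A = "Basis - {b0}"
  let ?K = "M ^ (DIM('a) - 1)"
  have card: "card ?A = DIM('a) - 1" using b0 by simp
  have "M ^ 1 \<le> ?K" using M dim by (intro power_increasing) auto
  then have K: "?K \<ge> 3" using M by simp
  from lattice_path_exists[of ?A M] M obtain P :: "nat \<Rightarrow> 'a \<Rightarrow> nat" where
    P: "(\<forall>i. P 0 i = 0) \<and> (\<forall>l<?K. \<forall>i\<in>?A. P l i < M) \<and>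
      (\<forall>l<?K. \<forall>l'<?K. (\<forall>i\<in>?A. P l i = P l' i) \<longrightarrow> l = l') \<and>
      (\<forall>l. Suc l < ?K \<longrightarrow> (\<exists>j\<in>?A. (\<forall>i\<in>?A. i \<noteq> j \<longrightarrow> P (Suc l) i = P l i) \<and>
          (P (Suc l) j = Suc (P l j) \<or> P l j = Suc (P (Suc l) j))))"
    unfolding card by auto
  define j where "j l = (SOME j. j \<in> ?A \<and> (\<forall>i\<in>?A. i \<noteq> j \<longrightarrow> P (Suc l) i = P l i) \<and>
          (P (Suc l) j = Suc (P l j) \<or> P l j = Suc (P (Suc l) j)))" for l
  have j: "j l \<in> ?A \<and> (\<forall>i\<in>?A. i \<noteq> j l \<longrightarrow> P (Suc l) i = P l i) \<and>
          (P (Suc l) (j l) = Suc (P l (j l)) \<or> P l (j l) = Suc (P (Suc l) (j l)))"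
    if "l < ?K - 1" for l
  proof -
    have "Suc l < ?K" using that by linarith
    from P[THEN conjunct2, THEN conjunct2, THEN conjunct2, rule_format, OF this]
    show ?thesis unfolding j_def Bex_def by (rule someI_ex)
  qed
  define d where "d l = real (P (Suc l) (j l)) - real (P l (j l))" for l
  have "snake b0 M (?K - 1) P j d"
  proof
    \<comment> \<open>An odd number of cells gives an even number of links; counted from 0, the last
      link is odd and hence a bottom bend, as the end of the tube requires.\<close>
    show "even (?K - 1)" using M K by simp
    show "2 \<le> ?K - 1" "1 \<le> M" using K M by auto
    show "d l = 1 \<or> d l = - 1" if "l < ?K - 1" for l
      using j[OF that] by (auto simp: d_def)
    show "l = l'" if "l \<le> ?K - 1" "l' \<le> ?K - 1" "\<forall>i\<in>?A. P l i = P l' i" for l l'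
    proof -
      have "l < ?K" "l' < ?K" using that K by auto
      then show ?thesis using P that(3) by blast
    qed
    show "P l i < M" if "l \<le> ?K - 1" "i \<in> ?A" for l i
    proof -
      have "l < ?K" using that K by auto
      then show ?thesis using P that(2) by blast
    qed
    show "P (Suc l) i = P l i" if "l < ?K - 1" "i \<in> ?A" "i \<noteq> j l" for l i
      using j[OF that(1)] that(2,3) by blast
    show "j l \<in> ?A" if "l < ?K - 1" for l
      using j[OF that] by blast
  qed (use b0 P in \<open>simp_all add: d_def\<close>)
  then show ?thesis by blast
qed

section \<open>Assembling the map and bounding its differential\<close>

lemma derivative_bound_on_compact:
  fixes f :: "'a::euclidean_space \<Rightarrow> 'c::euclidean_space"
  assumes "smooth_on_open U f" "compact Z" "Z \<subseteq> U"
  obtains B where "B \<ge> 0" "\<And>z v. z \<in> Z \<Longrightarrow> norm (frechet_derivative f (at z) v) \<le> B * norm v"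
proof -
  have "\<exists>c. \<forall>z\<in>Z. norm (frechet_derivative f (at z) b) \<le> c" for b
  proof -
    have "compact ((\<lambda>z. frechet_derivative f (at z) b) ` Z)"
      using continuous_on_subset[OF smooth_continuous_derivative[OF assms(1)] assms(3)] assms(2)
      by (rule compact_continuous_image)
    then have "bounded ((\<lambda>z. frechet_derivative f (at z) b) ` Z)" by (rule compact_imp_bounded)
    then obtain c where "\<forall>w\<in>(\<lambda>z. frechet_derivative f (at z) b) ` Z. norm w \<le> c"
      unfolding bounded_iff ..
    then show ?thesis by (intro exI[of _ c]) simp
  qed
  then have "\<exists>c. \<forall>b. \<forall>z\<in>Z. norm (frechet_derivative f (at z) b) \<le> c b" by (intro choice allI)
  then obtain c where c: "norm (frechet_derivative f (at z) b) \<le> c b" if "z \<in> Z" for b z by blast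
  define B where "B = (\<Sum>b\<in>Basis. \<bar>c b\<bar>)"
  show thesis
  proof
    show "B \<ge> 0" by (simp add: B_def sum_nonneg)
    fix z v assume z: "z \<in> Z"
    interpret linear "frechet_derivative f (at z)"
      using has_derivative_linear[OF smooth_has_derivative[OF assms(1)]] z assms(3) by blast
    have "frechet_derivative f (at z) v = frechet_derivative f (at z) (\<Sum>b\<in>Basis. (v \<bullet> b) *\<^sub>R b)"
      by (simp only: euclidean_representation)
    also have "\<dots> = (\<Sum>b\<in>Basis. (v \<bullet> b) *\<^sub>R frechet_derivative f (at z) b)"
      by (simp only: sum scaleR)
    finally have "norm (frechet_derivative f (at z) v) \<le> (\<Sum>b\<in>Basis. norm v * \<bar>c b\<bar>)"
    proof (elim ssubst, intro sum_norm_le)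
      fix b :: 'a assume b: "b \<in> Basis"
      have "norm (frechet_derivative f (at z) b) \<le> \<bar>c b\<bar>" using c[OF z, of b] by linarith
      then show "norm ((v \<bullet> b) *\<^sub>R frechet_derivative f (at z) b) \<le> norm v * \<bar>c b\<bar>"
        using Basis_le_norm[OF b, of v] by (simp add: mult_mono)
    qed
    then show "norm (frechet_derivative f (at z) v) \<le> B * norm v"
      by (simp add: B_def sum_distrib_left mult.commute)
  qed
qed

text \<open>Differentiating \<open>h y \<bullet> h y = 1\<close> confines the image of
  \<open>Dh\<close> to the hyperplane orthogonal to \<open>h x\<close>. This is how factoring
  through the sphere of dimension \<open>2 * n\<close> bounds the rank by
  \<open>2 * n\<close>.\<close>

lemma derivative_through_sphere:
  fixes h :: "'a::euclidean_space \<Rightarrow> 'b::euclidean_space" and f :: "'b \<Rightarrow> 'c::euclidean_space"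
  assumes h: "(h has_derivative Dh) (at x)" and "open S" "x \<in> S" "\<And>y. y \<in> S \<Longrightarrow> norm (h y) = 1"
    and f: "(f has_derivative Df) (at (h x))"
  obtains W where "range (\<lambda>v. Df (Dh v)) \<subseteq> W" "dim W \<le> DIM('b) - 1" "subspace W"
proof
  let ?H = "{w. h x \<bullet> w = 0}"
  have lin: "linear Df" using f by (rule has_derivative_linear)
  have "((\<lambda>y. h y \<bullet> h y) has_derivative (\<lambda>v. h x \<bullet> Dh v + Dh v \<bullet> h x)) (at x)"
    by (rule has_derivative_inner[OF h h])
  moreover have "((\<lambda>y. h y \<bullet> h y) has_derivative (\<lambda>v. 0)) (at x)"
    by (rule has_derivative_transform_within_open[OF has_derivative_const assms(2,3), of 1])
       (use assms(4) in \<open>simp add: norm_eq_1\<close>)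
  ultimately have "(\<lambda>v. h x \<bullet> Dh v + Dh v \<bullet> h x) = (\<lambda>v. 0)"
    by (rule has_derivative_unique)
  then have "h x \<bullet> Dh v = 0" for v
    by (auto simp: fun_eq_iff inner_commute)
  then show "range (\<lambda>v. Df (Dh v)) \<subseteq> Df ` ?H" by auto
  have "h x \<noteq> 0" using assms(3,4) by force
  then have "dim ?H = DIM('b) - 1" by (rule dim_hyperplane)
  then show "dim (Df ` ?H) \<le> DIM('b) - 1" using dim_image_le[OF lin, of ?H] by simp
  show "subspace (Df ` ?H)"
    using lin subspace_hyperplane by (rule linear_subspace_image)
qed

lemma prod_singular_value_scaled_le:
  fixes L L' :: "'a::euclidean_space \<Rightarrow> 'c::euclidean_space"
  assumes "linear L" "linear L'" "range L' \<subseteq> W" "dim W \<le> r"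
    and "\<And>v. norm (L v - L' v) \<le> e * norm v" "e \<ge> 0" "\<And>v. norm (L v) \<le> B * norm v" "B \<ge> 0" "R \<ge> 0"
  shows "(\<Prod>l<Suc r. singular_value (\<lambda>v. L (R *\<^sub>R v)) l) \<le> (R * B) ^ r * (R * e)"
proof (rule prod_singular_value_le)
  interpret L: linear L by fact
  interpret L': linear L' by fact
  show "linear (\<lambda>v. L (R *\<^sub>R v))" "linear (\<lambda>v. L' (R *\<^sub>R v))"
    by (auto intro!: linearI simp: L.add L.scaleR L'.add L'.scaleR scaleR_add_right)
  show "norm (L (R *\<^sub>R v)) \<le> R * B * norm v" for v
    using assms(7)[of "R *\<^sub>R v"] assms(9) by (simp add: mult_ac)
  show "norm (L (R *\<^sub>R v) - L' (R *\<^sub>R v)) \<le> R * e * norm v" for v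
    using assms(5)[of "R *\<^sub>R v"] assms(9) by (simp add: mult_ac)
qed (use assms in auto)

context snake begin

definition K :: "'a \<Rightarrow> 'a" where "K y = V y /\<^sub>R norm (V y)"

text \<open>The constants \<open>B0\<close>, \<open>C\<close> and \<open>Cg\<close> are hypotheses
  that do not mention \<open>M\<close>, so the bound depends on \<open>M\<close> only through
  \<open>R\<close>, \<open>M\<close> and \<open>N\<close>. The powers of \<open>R\<close> come from
  rescaling the ball of radius \<open>R\<close> to the unit ball.\<close>

lemma snake_extension:
  fixes G1 :: "'a \<Rightarrow> 'b::euclidean_space" and i1 :: "'b \<Rightarrow> 'c::euclidean_space"
    and B0 C Cg :: real
  assumes G1: "smooth_on_open U G1" "sphere 0 1 \<subseteq> U" "\<And>y. norm y = 1 \<Longrightarrow> norm (G1 y) = 1"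
    and i1: "smooth_on_open U' i1" "sphere 0 1 \<subseteq> U'"
    and C: "\<And>t. \<bar>frechet_derivative smooth_step (at t) 1\<bar> \<le> C"
    and Cg: "\<And>y. norm y = 1 \<Longrightarrow> norm (i1 (G1 y)) \<le> Cg" "Cg \<ge> 0"
    and B0: "\<And>z v. z \<bullet> b0 = 0 \<Longrightarrow> z \<bullet> z \<le> 1 \<Longrightarrow>
      norm (frechet_derivative (\<lambda>z. i1 (G1 (prof z /\<^sub>R norm (prof z)))) (at z) v) \<le> B0 * norm v"
    and B0_nonneg: "B0 \<ge> 0" and dim: "DIM('b) = Suc r" "r \<ge> 1"
  shows "\<exists>F :: 'a \<Rightarrow> 'c. smooth_on_open UNIV F \<and> (\<forall>x. norm x = 1 \<longrightarrow> F x = i1 (G1 x)) \<and>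
    (\<forall>x. \<exists>D. (F has_derivative D) (at x) \<and>
      (\<Prod>l<Suc r. singular_value D l) \<le> (R * (DIM('a) * B0 + Cg * C)) ^ r * (R * (Cg * C / (real M * real N))))"
proof -
  \<comment> \<open>\<open>e\<close> bounds the contribution of the slope of \<open>tau\<close>: a
    drop of \<open>1 / N\<close> over a height \<open>M\<close>, times the size of the map on the
    sphere.\<close>
  define e where "e = Cg * C / (real M * real N)"
  define B where "B = DIM('a) * B0 + Cg * C"
  have C0: "C \<ge> 0" using C[of 0] by linarith
  have e0: "e \<ge> 0" and B_nonneg: "B \<ge> 0" using C0 Cg(2) B0_nonneg by (auto simp: e_def B_def)
  define f where "f z = i1 (G1 z)" for z
  define F where "F y = tau y *\<^sub>R f (K y)" for y
  let ?O = "{y. V y \<noteq> 0}"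
  have O: "open ?O"
    using smooth_continuous_on[OF smooth_V] by (intro open_Collect_neq continuous_on_const) auto
  have normalized: "norm (z /\<^sub>R norm z) = 1" if "z \<noteq> 0" for z :: 'a
    using that by simp
  have nz: "open {z::'a. z \<noteq> 0}" by (simp add: open_Collect_neq)
  have smooth_h: "smooth_on_open S (\<lambda>y. G1 (g y /\<^sub>R norm (g y)))"
    if "smooth_on_open S g" "\<And>y. y \<in> S \<Longrightarrow> g y \<noteq> 0" for S and g :: "'a \<Rightarrow> 'a"
    using smooth_normalize[OF that] G1(2) normalized[OF that(2)]
    by (intro smooth_compose[OF G1(1)]) auto
  have smooth_f: "smooth_on_open S (\<lambda>y. f (g y /\<^sub>R norm (g y)))"
    if "smooth_on_open S g" "\<And>y. y \<in> S \<Longrightarrow> g y \<noteq> 0" for S and g :: "'a \<Rightarrow> 'a"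
    unfolding f_def using smooth_h[OF that] i1(2) G1(3)[OF normalized[OF that(2)]]
    by (intro smooth_compose[OF i1(1)]) auto
  have V_O: "smooth_on_open ?O V" using smooth_subset[OF smooth_V O] by simp
  have hK: "smooth_on_open ?O (\<lambda>y. G1 (K y))"
    unfolding K_def by (rule smooth_h[OF V_O]) simp
  have fK: "smooth_on_open ?O (\<lambda>y. f (K y))"
    unfolding K_def by (rule smooth_f[OF V_O]) simp
  \<comment> \<open>The normalization \<open>K\<close> is meaningless at zeros of \<open>V\<close>,
    but around them the factor \<open>tau\<close> is 0, so \<open>F\<close> is smooth there as
    well.\<close>
  have tau_zero: "\<forall>\<^sub>F y in nhds x. tau y = 0" if V0: "V x = 0" for x
  proof (cases rule: derivative_cases[OF C, of x])
    case (4 c D)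
    have "V x = prof (zc c x)" by (rule eventually_nhds_x_imp_x[OF 4(2)])
    then show ?thesis using V0 profile_neq_0[OF zc_inner_b0] by simp
  qed (use V0 in simp_all)
  have smooth_F: "smooth_on_open UNIV F"
  proof (rule smooth_local[OF open_UNIV])
    fix x
    show "\<exists>S. x \<in> S \<and> smooth_on_open S F"
    proof (cases "V x = 0")
      case False
      have "smooth_on_open ?O F"
        unfolding F_def[abs_def] by (intro smooth_scaleR fK smooth_subset[OF smooth_tau O]) simp
      then show ?thesis by (intro exI[of _ ?O] conjI) (simp_all add: False)
    next
      case True
      obtain S where S: "open S" "x \<in> S" "\<forall>y\<in>S. tau y = 0"
        using tau_zero[OF True] unfolding eventually_nhds by (elim exE conjE)
      have "smooth_on_open S F"
        by (rule smooth_cong[OF smooth_const[OF S(1), of 0]]) (simp add: F_def S(3))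
      then show ?thesis by (intro exI[of _ S] conjI S(2))
    qed
  qed
  have boundary: "F (R *\<^sub>R x) = i1 (G1 x)" if x: "norm x = 1" for x
  proof -
    have n: "(R *\<^sub>R x) \<bullet> (R *\<^sub>R x) = R\<^sup>2" using x by (simp add: norm_eq_1 power2_eq_square)
    have "V (R *\<^sub>R x) = R *\<^sub>R x" by (simp add: V_def w_eq_0[OF n])
    then have "K (R *\<^sub>R x) = x" using x R_pos by (simp add: K_def)
    moreover have "tau (R *\<^sub>R x) = 1" by (rule outer_tau) (use n in simp)
    ultimately show ?thesis by (simp add: F_def f_def)
  qed
  have point: "\<exists>D. (F has_derivative D) (at y) \<and>
      (\<Prod>l<Suc r. singular_value (\<lambda>v. D (R *\<^sub>R v)) l) \<le> (R * B) ^ r * (R * e)" for y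
  proof -
    \<comment> \<open>With \<open>L' = L\<close> the error is 0, so the singular value of index
      \<open>r\<close> vanishes and any bound \<open>b\<close> for \<open>L\<close>, however large,
      is good enough.\<close>
    have rank: "?thesis" if L: "(F has_derivative L) (at y)" and W: "range L \<subseteq> W" "dim W \<le> r" for L W
    proof -
      have bl: "bounded_linear L" using L by (rule has_derivative_bounded_linear)
      obtain b where b: "b \<ge> 0" "\<And>v. norm (L v) \<le> b * norm v"
        using bounded_linear.nonneg_bounded[OF bl] by (auto simp: mult.commute)
      have "(\<Prod>l<Suc r. singular_value (\<lambda>v. L (R *\<^sub>R v)) l) \<le> (R * b) ^ r * (R * 0)"
        using bl b W R_pos
        by (intro prod_singular_value_scaled_le[where L' = L]) (auto simp: bounded_linear.linear)
      also have "\<dots> \<le> (R * B) ^ r * (R * e)"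
        using R_pos B_nonneg e0 by simp
      finally show ?thesis using L by blast
    qed
    have zero: ?thesis if "\<forall>\<^sub>F z in nhds y. tau z = 0"
    proof -
      have "\<forall>\<^sub>F z in nhds y. F z = 0" using that by eventually_elim (simp add: F_def)
      from rank[OF has_derivative_eventually_eq[OF this has_derivative_const], of "{0}"] show ?thesis by simp
    qed
    show ?thesis
    proof (cases "V y = 0")
      case True
      then show ?thesis by (rule zero[OF tau_zero])
    next
      case False
      then have yO: "y \<in> ?O" by simp
      have K1: "norm (K z) = 1" if "z \<in> ?O" for z using that normalized by (simp add: K_def)
      define Dh where "Dh = frechet_derivative (\<lambda>y. G1 (K y)) (at y)"
      define Df where "Df = frechet_derivative i1 (at (G1 (K y)))"
      have Dh: "((\<lambda>y. G1 (K y)) has_derivative Dh) (at y)"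
        unfolding Dh_def by (rule smooth_has_derivative[OF hK yO])
      have Df: "(i1 has_derivative Df) (at (G1 (K y)))"
        unfolding Df_def using G1(3)[OF K1[OF yO]] i1(2) by (intro smooth_has_derivative[OF i1(1)]) auto
      obtain W where W: "range (\<lambda>v. Df (Dh v)) \<subseteq> W" "dim W \<le> DIM('b) - 1" "subspace W"
        using derivative_through_sphere[OF Dh O yO _ Df] G1(3) K1 by blast
      have DfK: "((\<lambda>y. f (K y)) has_derivative (\<lambda>v. Df (Dh v))) (at y)"
        unfolding f_def by (rule has_derivative_compose[OF Dh Df])
      have DF: "(F has_derivative (\<lambda>v. tau y *\<^sub>R Df (Dh v) + Dt v *\<^sub>R f (K y))) (at y)"
        if "(tau has_derivative Dt) (at y)" for Dt
        unfolding F_def[abs_def] by (rule has_derivative_scaleR[OF that DfK])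
      have rangeW: "range (\<lambda>v. tau y *\<^sub>R Df (Dh v)) \<subseteq> W"
        using W(1) subspace_scale[OF W(3)] by auto
      have fKy: "norm (f (K y)) \<le> Cg" unfolding f_def by (rule Cg(1)[OF K1[OF yO]])
      show ?thesis
      proof (cases rule: derivative_cases[OF C, of y])
        case 1
        from DF[OF 1(2)] have "(F has_derivative (\<lambda>v. tau y *\<^sub>R Df (Dh v))) (at y)" by simp
        then show ?thesis using rank[OF _ rangeW] W(2) dim(1) by simp
      next
        case 2
        let ?\<nu> = "\<lambda>z::'a. f (z /\<^sub>R norm z)"
        have "smooth_on_open {z. z \<noteq> 0} ?\<nu>"
          by (rule smooth_f[OF smooth_id[OF nz]]) simp
        then have D\<nu>: "(?\<nu> has_derivative frechet_derivative ?\<nu> (at (V y))) (at (V y))"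
          using False by (intro smooth_has_derivative) auto
        have "((\<lambda>y. f (K y)) has_derivative (\<lambda>v. frechet_derivative ?\<nu> (at (V y)) 0)) (at y)"
          unfolding K_def using has_derivative_compose[OF 2(2) D\<nu>] .
        from has_derivative_unique[OF DfK this] have 0: "Df (Dh v) = 0" for v
          using linear_0[OF has_derivative_linear[OF D\<nu>]] by (simp add: fun_eq_iff)
        have "(tau has_derivative frechet_derivative tau (at y)) (at y)"
          by (rule smooth_has_derivative[OF smooth_tau UNIV_I])
        from DF[OF this] have "(F has_derivative (\<lambda>v. frechet_derivative tau (at y) v *\<^sub>R f (K y))) (at y)"
          by (simp add: 0)
        moreover have "range (\<lambda>v. frechet_derivative tau (at y) v *\<^sub>R f (K y)) \<subseteq> span {f (K y)}"
          by (auto intro: span_scale span_base)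
        moreover have "dim (span {f (K y)}) \<le> r"
          using dim_le_card'[of "{f (K y)}"] dim(2) by (simp add: dim_span)
        ultimately show ?thesis by (rule rank)
      next
        case 3
        then show ?thesis by (rule zero)
      next
        case (4 c Dt)
        let ?\<Gamma> = "\<lambda>z. f (prof z /\<^sub>R norm (prof z))"
        let ?Z = "{z. prof z \<noteq> 0}"
        have prof: "smooth_on_open UNIV prof" by (intro smooth_intros) simp
        have Z: "open ?Z"
          using smooth_continuous_on[OF prof] by (intro open_Collect_neq continuous_on_const) auto
        have "smooth_on_open ?Z ?\<Gamma>"
          by (rule smooth_f[OF smooth_subset[OF prof Z]]) simp_all
        then have D\<Gamma>: "(?\<Gamma> has_derivative frechet_derivative ?\<Gamma> (at (zc c y))) (at (zc c y))"
          using profile_neq_0[OF zc_inner_b0] by (intro smooth_has_derivative) auto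
        obtain \<Lambda> where \<Lambda>: "(zc c has_derivative \<Lambda>) (at y)" "\<And>v. norm (\<Lambda> v) \<le> DIM('a) * norm v"
          by (rule zc_has_derivative) blast
        have ev: "\<forall>\<^sub>F z in nhds y. f (K z) = ?\<Gamma> (zc c z)"
          using 4(2) by eventually_elim (simp add: K_def)
        have "(\<lambda>v. Df (Dh v)) = (\<lambda>v. frechet_derivative ?\<Gamma> (at (zc c y)) (\<Lambda> v))"
          by (rule has_derivative_unique[OF DfK has_derivative_eventually_eq[OF ev has_derivative_compose[OF \<Lambda>(1) D\<Gamma>]]])
        then have eq: "Df (Dh v) = frechet_derivative ?\<Gamma> (at (zc c y)) (\<Lambda> v)" for v by metis
        have DfDh: "norm (Df (Dh v)) \<le> B0 * (DIM('a) * norm v)" for v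
        proof -
          have "norm (Df (Dh v)) \<le> B0 * norm (\<Lambda> v)"
            unfolding eq f_def by (rule B0[OF zc_inner_b0 4(1)])
          also have "\<dots> \<le> B0 * (DIM('a) * norm v)"
            by (intro mult_left_mono \<Lambda>(2) B0_nonneg)
          finally show ?thesis .
        qed
        have Dt: "norm (Dt v *\<^sub>R f (K y)) \<le> e * norm v" for v
        proof -
          have "\<bar>Dt v\<bar> * norm (f (K y)) \<le> (C / (real M * real N) * norm v) * Cg"
            using C0 by (intro mult_mono 4(5) fKy) auto
          then show ?thesis by (simp add: e_def mult_ac)
        qed
        \<comment> \<open>Replacing \<open>e\<close> by \<open>Cg * C\<close> keeps the bound
          \<open>B\<close> on the whole differential independent of \<open>M\<close> and
          \<open>N\<close>.\<close>
        have "1 * 1 \<le> real M * real N" using M N(2) by (intro mult_mono) auto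
        then have "Cg * C / (real M * real N) \<le> Cg * C / 1"
          using C0 Cg(2) by (intro divide_left_mono) auto
        then have "e \<le> Cg * C" by (simp add: e_def)
        have LB: "norm (tau y *\<^sub>R Df (Dh v) + Dt v *\<^sub>R f (K y)) \<le> B * norm v" for v
        proof -
          have "norm (tau y *\<^sub>R Df (Dh v) + Dt v *\<^sub>R f (K y)) \<le> \<bar>tau y\<bar> * norm (Df (Dh v)) + e * norm v"
            using norm_triangle_ineq[of "tau y *\<^sub>R Df (Dh v)" "Dt v *\<^sub>R f (K y)"] Dt[of v] by simp
          also have "\<dots> \<le> 1 * (B0 * (DIM('a) * norm v)) + (Cg * C) * norm v"
            using C0 Cg(2) DfDh[of v] 4(3) \<open>e \<le> Cg * C\<close> by (intro add_mono mult_mono) auto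
          also have "\<dots> = B * norm v" by (simp add: B_def algebra_simps)
          finally show ?thesis .
        qed
        have "(\<Prod>l<Suc r. singular_value (\<lambda>v. tau y *\<^sub>R Df (Dh (R *\<^sub>R v)) + Dt (R *\<^sub>R v) *\<^sub>R f (K y)) l)
            \<le> (R * B) ^ r * (R * e)"
        proof (rule prod_singular_value_scaled_le[where W = W and L' = "\<lambda>v. tau y *\<^sub>R Df (Dh v)"])
          show "linear (\<lambda>v. tau y *\<^sub>R Df (Dh v) + Dt v *\<^sub>R f (K y))"
            using has_derivative_linear[OF DF[OF 4(4)]] .
          show "linear (\<lambda>v. tau y *\<^sub>R Df (Dh v))"
            using has_derivative_linear[OF has_derivative_scaleR_right[OF DfK, of "tau y"]] .
        qed (use rangeW W(2) dim Dt e0 LB B_nonneg R_pos in auto)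
        then show ?thesis using DF[OF 4(4)] by blast
      qed
    qed
  qed
  have scale: "((\<lambda>x. R *\<^sub>R x) has_derivative (\<lambda>v. R *\<^sub>R v)) (at x)" for x :: 'a
    by (auto intro!: derivative_eq_intros)
  have "smooth_on_open UNIV (\<lambda>x::'a. R *\<^sub>R x)" by (intro smooth_intros) auto
  then have "smooth_on_open UNIV (\<lambda>x. F (R *\<^sub>R x))" by (intro smooth_compose[OF smooth_F]) auto
  moreover have "\<exists>D. ((\<lambda>x. F (R *\<^sub>R x)) has_derivative D) (at x) \<and>
      (\<Prod>l<Suc r. singular_value D l) \<le> (R * B) ^ r * (R * e)" for x
    using point[of "R *\<^sub>R x"] has_derivative_compose[OF scale] by blast
  ultimately show ?thesis
    using boundary unfolding e_def B_def by (intro exI[of _ "\<lambda>x. F (R *\<^sub>R x)"]) simp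
qed

end

section \<open>Null-homotopies of small dilation\<close>

text \<open>Both \<open>m\<close> and \<open>k\<close> stand for the dimension of the source, and
  \<open>k \<ge> r + 2\<close> becomes \<open>4 * n \<ge> 2 * n + 2\<close>. The radius contributes
  \<open>M ^ Suc r\<close>, which the number of links cancels up to a factor 2; the length
  \<open>M\<close> of a straight piece leaves the factor \<open>1 / M\<close>.\<close>

lemma growth_estimate:
  fixes B c m :: real
  assumes "B \<ge> 0" "c \<ge> 0" "m \<ge> 0" "M \<ge> 3" "k \<ge> r + 2"
  shows "(4 * m * (real M + 3) * B) ^ r * (4 * m * (real M + 3) * (c / (real M * real (M ^ (k - 1) - 1))))
    \<le> (16 * m) ^ Suc r * B ^ r * c * 2 / real M"
proof -
  define x where "x = real M"
  define N where "N = real (M ^ (k - 1) - 1)"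
  have x: "x \<ge> 3" using assms(4) by (simp add: x_def)
  have pow: "x ^ Suc r \<le> x ^ (k - 1)" using x assms(5) by (intro power_increasing) auto
  have "1 \<le> M ^ (k - 1)" using assms(4) by simp
  then have N_eq: "N = x ^ (k - 1) - 1" by (simp add: N_def x_def of_nat_diff)
  have "x ^ 1 \<le> x ^ Suc r" using x by (intro power_increasing) auto
  then have "3 \<le> x ^ Suc r" using x unfolding power_one_right by (rule order_trans[rotated])
  then have N: "x ^ Suc r \<le> 2 * N" "N > 0" using pow N_eq by linarith+
  have "(4 * m * (x + 3) * B) ^ r * (4 * m * (x + 3) * (c / (x * N)))
      = (4 * m * (x + 3)) ^ Suc r * (B ^ r * c / (x * N))"
    by (simp add: power_mult_distrib)
  also have "\<dots> \<le> (16 * m * x) ^ Suc r * (B ^ r * c / (x * N))"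
  proof (intro mult_right_mono power_mono)
    have "m * (x + 3) \<le> m * (4 * x)" using x assms(3) by (intro mult_left_mono) auto
    then show "4 * m * (x + 3) \<le> 16 * m * x" by simp
  qed (use assms x N in auto)
  also have "\<dots> = (16 * m) ^ Suc r * B ^ r * c * (x ^ Suc r / (x * N))"
    by (simp add: power_mult_distrib)
  also have "\<dots> \<le> (16 * m) ^ Suc r * B ^ r * c * (2 / x)"
  proof (intro mult_left_mono)
    show "x ^ Suc r / (x * N) \<le> 2 / x" using N x by (simp add: divide_simps mult.commute)
  qed (use assms in auto)
  finally show ?thesis by (simp add: x_def N_def)
qed

lemma smooth_on_extend:
  assumes "smooth_on S f"
  obtains U g where "smooth_on_open U g" "S \<subseteq> U" "\<And>x. x \<in> S \<Longrightarrow> g x = f x"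
  using assms unfolding smooth_on_def smooth_on_open_def by metis

theorem corollary1p4:
  fixes n k :: nat
    and G :: "'a::euclidean_space \<Rightarrow> 'b::euclidean_space"
    and i :: "'b \<Rightarrow> 'c::euclidean_space"
    and h :: real
  assumes "n \<ge> 1" and "k \<ge> 1"
    and "DIM('a) = 4 * n" and "DIM('b) = 2 * n + 1" and "DIM('c) = k"
    and "smooth_on (sphere 0 1) G" and "G ` sphere 0 1 \<subseteq> sphere 0 1"
    and "has_Hopf_invariant n G h" and "h \<noteq> 0"
    and "smooth_sphere_embedding i"
  shows "\<forall>\<epsilon>>0. \<exists>F :: 'a \<Rightarrow> 'c.
           smooth_on (cball 0 1) F \<and>
           (\<forall>x\<in>sphere 0 1. F x = i (G x)) \<and>
           dil (2 * n + 1) (cball 0 1) F < ennreal \<epsilon>"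
proof (intro allI impI)
  fix \<epsilon> :: real assume \<epsilon>: "\<epsilon> > 0"
  obtain U G1 where G1: "smooth_on_open U G1" "sphere 0 1 \<subseteq> U" "\<And>x. x \<in> sphere 0 1 \<Longrightarrow> G1 x = G x"
    using smooth_on_extend[OF assms(6)] by metis
  have "smooth_on (sphere 0 1) i" using assms(10) by (simp add: smooth_sphere_embedding_def)
  then obtain U' i1 where i1: "smooth_on_open U' i1" "sphere 0 1 \<subseteq> U'" "\<And>x. x \<in> sphere 0 1 \<Longrightarrow> i1 x = i x"
    using smooth_on_extend by metis
  have G1_sphere: "norm (G1 y) = 1" if "norm y = 1" for y
  proof -
    have "y \<in> sphere 0 1" using that by simp
    then have "G1 y \<in> sphere 0 1" using G1(3)[of y] assms(7) by (metis image_subset_iff)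
    then show ?thesis by simp
  qed
  define f where "f y = i1 (G1 y)" for y
  have smooth_f: "smooth_on_open S (\<lambda>y. f (g y /\<^sub>R norm (g y)))"
    if g: "smooth_on_open S g" "\<And>y. y \<in> S \<Longrightarrow> g y \<noteq> 0" for S and g :: "'a \<Rightarrow> 'a"
  proof -
    have n: "norm (g y /\<^sub>R norm (g y)) = 1" if "y \<in> S" for y using g(2)[OF that] by simp
    have "smooth_on_open S (\<lambda>y. G1 (g y /\<^sub>R norm (g y)))"
      by (rule smooth_compose[OF G1(1) smooth_normalize[OF g]]) (use n G1(2) in auto)
    then show ?thesis unfolding f_def
      by (rule smooth_compose[OF i1(1)]) (use G1_sphere[OF n] i1(2) in auto)
  qed
  obtain b0 :: 'a where b0: "b0 \<in> Basis" using nonempty_Basis by blast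
  let ?p = "tube_profile b0"
  \<comment> \<open>The coordinates \<open>zc c x\<close> at points of descent lie in this disc,
    whatever \<open>M\<close> is, so compactness gives a bound free of \<open>M\<close>.\<close>
  let ?Z = "{z. z \<bullet> b0 = 0} \<inter> cball 0 1"
  have smooth_p: "smooth_on_open UNIV ?p" by (intro smooth_intros) simp
  have Z: "open {z. ?p z \<noteq> 0}"
    using smooth_continuous_on[OF smooth_p] by (intro open_Collect_neq continuous_on_const) auto
  have "smooth_on_open {z. ?p z \<noteq> 0} (\<lambda>z. f (?p z /\<^sub>R norm (?p z)))"
    by (rule smooth_f[OF smooth_subset[OF smooth_p Z]]) simp_all
  moreover have "compact ?Z"
    using closed_hyperplane[of b0 0] by (intro closed_Int_compact) (simp_all add: inner_commute)
  moreover have "?Z \<subseteq> {z. ?p z \<noteq> 0}" using tube_profile_neq_0[OF b0] by blast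
  ultimately obtain B0 where B0: "B0 \<ge> 0" "\<And>z v. z \<in> ?Z \<Longrightarrow>
      norm (frechet_derivative (\<lambda>z. f (?p z /\<^sub>R norm (?p z))) (at z) v) \<le> B0 * norm v"
    by (rule derivative_bound_on_compact) blast
  obtain C where C: "C \<ge> 0" "\<And>t. \<bar>frechet_derivative smooth_step (at t) 1\<bar> \<le> C"
    by (rule smooth_step_derivative_bound) blast
  have "continuous_on (sphere 0 1) f"
  proof -
    have "continuous_on (sphere 0 1) (\<lambda>y. i1 (G1 y))"
      by (rule continuous_on_compose2[OF smooth_continuous_on[OF i1(1)]
            continuous_on_subset[OF smooth_continuous_on[OF G1(1)] G1(2)]])
         (use G1_sphere i1(2) in auto)
    then show ?thesis by (simp add: f_def[abs_def])
  qed
  then have "bounded (f ` sphere 0 1)"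
    by (intro compact_imp_bounded compact_continuous_image) auto
  then obtain Cg0 where Cg0: "\<forall>w\<in>f ` sphere 0 1. norm w \<le> Cg0" unfolding bounded_iff ..
  define Cg where "Cg = max Cg0 0"
  have Cg: "norm (f y) \<le> Cg" if "norm y = 1" for y
    using Cg0 that by (force simp: Cg_def)
  have Cg_nonneg: "Cg \<ge> 0" by (simp add: Cg_def)
  define r where "r = 2 * n"
  define B where "B = DIM('a) * B0 + Cg * C"
  \<comment> \<open>The numerator in \<open>growth_estimate\<close>. It is fixed before
    \<open>M\<close> is chosen, since \<open>B0\<close>, \<open>C\<close> and \<open>Cg\<close>
    depend only on the given maps, their extensions and \<open>b0\<close>.\<close>
  define Q where "Q = (16 * real DIM('a)) ^ Suc r * B ^ r * (Cg * C) * 2"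
  obtain t :: nat where t: "real t > Q / (\<epsilon> / 2)" using reals_Archimedean2 by blast
  \<comment> \<open>Odd and at least 3, as the tube requires, and larger than
    \<open>t\<close>.\<close>
  define M where "M = 2 * t + 3"
  have M: "odd M" "M \<ge> 3" by (auto simp: M_def)
  have "Q / (\<epsilon> / 2) \<le> real M" using t by (simp add: M_def)
  then have small: "Q / M \<le> \<epsilon> / 2"
    using \<epsilon> M(2) by (simp add: divide_simps mult.commute split: if_splits)
  have "DIM('a) \<ge> 2" using assms(1,3) by simp
  from snake_exists[OF b0 M this] obtain P j d where "snake b0 M (M ^ (DIM('a) - 1) - 1) P j d"
    by blast
  then interpret S: snake b0 M "M ^ (DIM('a) - 1) - 1" P j d .
  have "z \<in> ?Z" if "z \<bullet> b0 = 0" "z \<bullet> z \<le> 1" for z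
    using that by (simp add: norm_le_square)
  then have B0': "norm (frechet_derivative (\<lambda>z. i1 (G1 (?p z /\<^sub>R norm (?p z)))) (at z) v) \<le> B0 * norm v"
    if "z \<bullet> b0 = 0" "z \<bullet> z \<le> 1" for z v
    using B0(2)[of z v] that unfolding f_def by blast
  have dims: "DIM('b) = Suc r" "r \<ge> 1" using assms(1,4) by (auto simp: r_def)
  from S.snake_extension[OF G1(1,2) G1_sphere i1(1,2) C(2) Cg[unfolded f_def] Cg_nonneg B0' B0(1) dims]
  obtain F where F: "smooth_on_open UNIV F" "\<And>x. norm x = 1 \<Longrightarrow> F x = i1 (G1 x)"
    "\<And>x. \<exists>D. (F has_derivative D) (at x) \<and> (\<Prod>l<Suc r. singular_value D l)
      \<le> (S.R * B) ^ r * (S.R * (Cg * C / (real M * real (M ^ (DIM('a) - 1) - 1))))"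
    unfolding B_def by blast
  have R: "S.R = 4 * real DIM('a) * (real M + 3)" by (simp add: S.R_def)
  have "(S.R * B) ^ r * (S.R * (Cg * C / (real M * real (M ^ (DIM('a) - 1) - 1)))) \<le> Q / M"
    unfolding Q_def R using assms(1,3) M(2) B0(1) C(1) Cg_nonneg
    by (intro growth_estimate) (auto simp: B_def r_def)
  with small F(3) have F3: "\<exists>D. (F has_derivative D) (at x) \<and> (\<Prod>l<Suc r. singular_value D l) \<le> \<epsilon> / 2" for x
    by (meson order_trans)
  have "dil (Suc r) (cball 0 1) F \<le> ennreal (\<epsilon> / 2)"
    by (rule dil_cball_le[OF F3])
  also have "\<dots> < ennreal \<epsilon>" using \<epsilon> by (simp add: ennreal_lessI)
  finally have "dil (2 * n + 1) (cball 0 1) F < ennreal \<epsilon>" by (simp add: r_def)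
  moreover have "smooth_on (cball 0 1) F"
    using F(1) unfolding smooth_on_def smooth_on_open_def by blast
  moreover have "F x = i (G x)" if x: "x \<in> sphere 0 1" for x
  proof -
    have "G x \<in> sphere 0 1" using assms(7) x by blast
    then show ?thesis using F(2)[of x] x G1(3)[OF x] i1(3) by simp
  qed
  ultimately show "\<exists>F :: 'a \<Rightarrow> 'c. smooth_on (cball 0 1) F \<and> (\<forall>x\<in>sphere 0 1. F x = i (G x)) \<and>
      dil (2 * n + 1) (cball 0 1) F < ennreal \<epsilon>"
    by blast
qed

end
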